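(* Let $(a,b)\in\mathcal P$. If the map $f_{a,b}$ satisfies the finiteness condition, then for almost every point $(x,y)\in\bar{\mathbb R}^2\setminus\Delta$ there exists $N>0$ such that $F_{a,b}^N(x,y)\in D_{a,b}$.
   Context: $T(x)=x+1$ and $S(x)=-1/x$, acting on $\bar{\mathbb R}=\mathbb R\cup\{\infty\}$ and generating the modular group $SL(2,\mathbb Z)$ (acting by fractional linear transformations). $\mathcal P=\{(a,b)\in\mathbb R^2 : a\le 0\le b,\ b-a\ge 1,\ -ab\le 1\}$; the degenerate cases $a=0$, $b=0$, $(a,b)=(-1,1)$ are excluded. The map $f=f_{a,b}:\bar{\mathbb R}\to\bar{\mathbb R}$ is $f(x)=x+1$ if $x<a$, $f(x)=-1/x$ if $a\le x<b$, $f(x)=x-1$ if $x\ge b$. With $\Delta=\{(x,y)\in\bar{\mathbb R}^2:x=y\}$, $F_{a,b}:\bar{\mathbb R}^2\setminus\Delta\to\bar{\mathbb R}^2\setminus\Delta$ is $F_{a,b}(x,y)=(x+1,y+1)$ if $y<a$, $(-1/x,-1/y)$ if $a\le y<b$, $(x-1,y-1)$ if $y\ge b$. "Almost every" is with respect to Lebesgue measure. Orbits: the upper orbit of $a$ is $\{f^n(Sa)\}_{n\ge0}$, the lower orbit of $a$ is $\{f^n(Ta)\}_{n\ge0}$, the lower orbit of $b$ is $\{f^n(Sb)\}_{n\ge0}$ and the upper orbit of $b$ is $\{f^n(T^{-1}b)\}_{n\ge0}$. Convention: a lower orbit hitting $a$ (resp. $b$) continues with $Ta$ (resp. $Sb$);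 an upper orbit hitting $a$ (resp. $b$) continues with $Sa$ (resp. $T^{-1}b$). Cycles: $a$ has the cycle property if $f^{m_1}(Sa)=f^{k_1}(Ta)$ for some non-negative integers $m_1,k_1$ (the cycle being taken up to the first common value); its upper part is $\{Sa,\dots,f^{m_1-1}Sa\}$, its lower part $\{Ta,\dots,f^{k_1-1}Ta\}$; it is strong if $T^{-1}f^{-k_1}f^{m_1}S=\mathrm{Id}$ (powers of $f$ denoting the products of $T,S,T^{-1}$ applied along the orbit), weak otherwise. Likewise $b$ has the cycle property if $f^{k_2}(Sb)=f^{m_2}(T^{-1}b)$, with lower part $\{Sb,\dots,f^{k_2-1}Sb\}$ and upper part $\{T^{-1}b,\dots,f^{m_2-1}T^{-1}b\}$, strong if $Tf^{-m_2}f^{k_2}S=\mathrm{Id}$, weak otherwise. Truncated orbits: for $c\in\{a,b\}$, $\mathcal L_c$ (resp. $\mathcal U_c$) is the whole lower (resp. upper) orbit of $c$ if $c$ has no cycle property; the lower (resp. upper) part of the $c$-cycle if $c$ has the strong cycle property; the lower (resp. upper) part together with $0$ if $c$ has the weak cycle property. $f_{a,b}$ satisfies the finiteness condition if $\mathcal L_a,\mathcal L_b,\mathcal U_a,\mathcal U_b$ are all finite sets. Attractor: $D_{a,b}=\bigcap_{n\ge0}D_n$, $D_n=\bigcap_{i=0}^nF_{a,b}^i(\Theta_{a,b})$, where $\Theta_{a,b}=\Theta^u_{a,b}\cup\Theta^l_{a,b}\subset\bar{\mathbb R}^2\setminus\Delta$ with $\Theta^u_{a,b}=[-\infty,-1]\times[b-1,\infty]\cup[-1,0]\times[-\frac1a,\infty]$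 if $b\ge1$; $\Theta^u_{a,b}=[-\infty,-1]\times[b-1,\infty]\cup[-1,0]\times[\min(-\frac b{b-1},-\frac1a),\infty]\cup[0,1]\times[-\frac1{b-1},\infty]$ if $0<b<1$; $\Theta^l_{a,b}=[0,1]\times[-\infty,-\frac1b]\cup[1,\infty]\times[-\infty,a+1]$ if $a\le-1$; $\Theta^l_{a,b}=[-1,0]\times[-\infty,-\frac1{a+1}]\cup[0,1]\times[-\infty,\max(\frac a{a+1},-\frac1b)]\cup[1,\infty]\times[-\infty,a+1]$ if $-1<a<0$. In intervals $\pm\infty$ both denote the point $\infty$. *)

theory Defs
  imports "HOL-Analysis.Analysis"
begin

text \<open>The projective line, i.e. the reals with a single point at infinity (the library type
  \<^typ>\<open>ereal\<close> has two).\<close>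

datatype rbar = Fin real | Infty

fun mT :: "rbar \<Rightarrow> rbar" where
  "mT (Fin x) = Fin (x + 1)"
| "mT Infty = Infty"

fun mTi :: "rbar \<Rightarrow> rbar" where
  "mTi (Fin x) = Fin (x - 1)"
| "mTi Infty = Infty"

fun mS :: "rbar \<Rightarrow> rbar" where
  "mS (Fin x) = (if x = 0 then Infty else Fin (- 1 / x))"
| "mS Infty = Fin 0"

definition params :: "(real \<times> real) set" where
  "params = {(a, b). a \<le> 0 \<and> 0 \<le> b \<and> b - a \<ge> 1 \<and> - a * b \<le> 1}"

text \<open>\<open>branch a b x\<close> is the transformation among $T$, $S$, $T^{-1}$ that $f_{a,b}$ applies at \<open>x\<close>.
  The point at infinity is counted as \<open>\<ge> b\<close>; the value of $f_{a,b}$ there does not depend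
  on this.\<close>

fun branch :: "real \<Rightarrow> real \<Rightarrow> rbar \<Rightarrow> rbar \<Rightarrow> rbar" where
  "branch a b (Fin x) = (if x < a then mT else if x < b then mS else mTi)"
| "branch a b Infty = mTi"

definition f_map :: "real \<Rightarrow> real \<Rightarrow> rbar \<Rightarrow> rbar" where
  "f_map a b x = branch a b x x"

text \<open>The map $F_{a,b}$ is written on all pairs; the branches are injective, so it preserves the
  complement of the diagonal.\<close>

fun F_map :: "real \<Rightarrow> real \<Rightarrow> rbar \<times> rbar \<Rightarrow> rbar \<times> rbar" where
  "F_map a b (x, y) = (branch a b y x, branch a b y y)"

text \<open>Along upper and lower orbits, \<^const>\<open>f_map\<close> is iterated with prescribed branches at
  the discontinuities \<open>a\<close> and \<open>b\<close>. For upper orbits these are the branches of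
  \<^const>\<open>f_map\<close> itself.\<close>

definition upper_branch :: "real \<Rightarrow> real \<Rightarrow> rbar \<Rightarrow> rbar \<Rightarrow> rbar" where
  "upper_branch a b = (branch a b)(Fin a := mS, Fin b := mTi)"

definition lower_branch :: "real \<Rightarrow> real \<Rightarrow> rbar \<Rightarrow> rbar \<Rightarrow> rbar" where
  "lower_branch a b = (branch a b)(Fin a := mT, Fin b := mS)"

definition orb :: "(rbar \<Rightarrow> rbar \<Rightarrow> rbar) \<Rightarrow> rbar \<Rightarrow> nat \<Rightarrow> rbar" where
  "orb br c n = ((\<lambda>x. br x x) ^^ n) c"

text \<open>The power $f^n$ along the orbit of \<open>c\<close>, as a product of $T$, $S$, $T^{-1}$.\<close>

fun orb_word :: "(rbar \<Rightarrow> rbar \<Rightarrow> rbar) \<Rightarrow> rbar \<Rightarrow> nat \<Rightarrow> rbar \<Rightarrow> rbar" where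
  "orb_word br c 0 = id"
| "orb_word br c (Suc n) = br (orb br c n) \<circ> orb_word br c n"

definition upper_a :: "real \<Rightarrow> real \<Rightarrow> nat \<Rightarrow> rbar" where
  "upper_a a b = orb (upper_branch a b) (mS (Fin a))"

definition lower_a :: "real \<Rightarrow> real \<Rightarrow> nat \<Rightarrow> rbar" where
  "lower_a a b = orb (lower_branch a b) (mT (Fin a))"

definition upper_b :: "real \<Rightarrow> real \<Rightarrow> nat \<Rightarrow> rbar" where
  "upper_b a b = orb (upper_branch a b) (mTi (Fin b))"

definition lower_b :: "real \<Rightarrow> real \<Rightarrow> nat \<Rightarrow> rbar" where
  "lower_b a b = orb (lower_branch a b) (mS (Fin b))"

definition cycle_property :: "(nat \<Rightarrow> rbar) \<Rightarrow> (nat \<Rightarrow> rbar) \<Rightarrow> bool" where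
  "cycle_property u l \<longleftrightarrow> (\<exists>m k. u m = l k)"

text \<open>The first common value of an upper orbit \<open>u\<close> and a lower orbit \<open>l\<close> is \<open>u m = l k\<close> for
  \<open>m = cycle_upper_len u l\<close> and \<open>k = cycle_lower_len u l\<close>. This pair is minimal for the
  componentwise order; should there be several minimal pairs, the one with the smallest \<open>m\<close> is
  taken. Both are meaningful only under \<^const>\<open>cycle_property\<close>.\<close>

definition cycle_upper_len :: "(nat \<Rightarrow> rbar) \<Rightarrow> (nat \<Rightarrow> rbar) \<Rightarrow> nat" where
  "cycle_upper_len u l = (LEAST m. \<exists>k. u m = l k)"

definition cycle_lower_len :: "(nat \<Rightarrow> rbar) \<Rightarrow> (nat \<Rightarrow> rbar) \<Rightarrow> nat" where
  "cycle_lower_len u l = (LEAST k. u (cycle_upper_len u l) = l k)"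

text \<open>All transformations below are bijections of \<^typ>\<open>rbar\<close>, so \<^const>\<open>inv\<close> is the
  group inverse.\<close>

definition strong_cycle_a :: "real \<Rightarrow> real \<Rightarrow> bool" where
  "strong_cycle_a a b \<longleftrightarrow>
     cycle_property (upper_a a b) (lower_a a b) \<and>
     (let m = cycle_upper_len (upper_a a b) (lower_a a b);
          k = cycle_lower_len (upper_a a b) (lower_a a b)
      in mTi \<circ> inv (orb_word (lower_branch a b) (mT (Fin a)) k)
           \<circ> orb_word (upper_branch a b) (mS (Fin a)) m \<circ> mS = id)"

definition strong_cycle_b :: "real \<Rightarrow> real \<Rightarrow> bool" where
  "strong_cycle_b a b \<longleftrightarrow>
     cycle_property (upper_b a b) (lower_b a b) \<and>
     (let m = cycle_upper_len (upper_b a b) (lower_b a b);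
          k = cycle_lower_len (upper_b a b) (lower_b a b)
      in mT \<circ> inv (orb_word (upper_branch a b) (mTi (Fin b)) m)
           \<circ> orb_word (lower_branch a b) (mS (Fin b)) k \<circ> mS = id)"

text \<open>Truncation of an orbit \<open>s\<close> whose part in the cycle (if there is one) has length \<open>n\<close>.\<close>

definition truncate_orbit :: "bool \<Rightarrow> bool \<Rightarrow> (nat \<Rightarrow> rbar) \<Rightarrow> nat \<Rightarrow> rbar set" where
  "truncate_orbit cycle strong s n =
     (if \<not> cycle then range s
      else if strong then s ` {..<n}
      else s ` {..<n} \<union> {Fin 0})"

definition trunc_U_a :: "real \<Rightarrow> real \<Rightarrow> rbar set" where
  "trunc_U_a a b = truncate_orbit (cycle_property (upper_a a b) (lower_a a b)) (strong_cycle_a a b)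
     (upper_a a b) (cycle_upper_len (upper_a a b) (lower_a a b))"

definition trunc_L_a :: "real \<Rightarrow> real \<Rightarrow> rbar set" where
  "trunc_L_a a b = truncate_orbit (cycle_property (upper_a a b) (lower_a a b)) (strong_cycle_a a b)
     (lower_a a b) (cycle_lower_len (upper_a a b) (lower_a a b))"

definition trunc_U_b :: "real \<Rightarrow> real \<Rightarrow> rbar set" where
  "trunc_U_b a b = truncate_orbit (cycle_property (upper_b a b) (lower_b a b)) (strong_cycle_b a b)
     (upper_b a b) (cycle_upper_len (upper_b a b) (lower_b a b))"

definition trunc_L_b :: "real \<Rightarrow> real \<Rightarrow> rbar set" where
  "trunc_L_b a b = truncate_orbit (cycle_property (upper_b a b) (lower_b a b)) (strong_cycle_b a b)
     (lower_b a b) (cycle_lower_len (upper_b a b) (lower_b a b))"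

definition finiteness_condition :: "real \<Rightarrow> real \<Rightarrow> bool" where
  "finiteness_condition a b \<longleftrightarrow>
     finite (trunc_L_a a b) \<and> finite (trunc_L_b a b) \<and>
     finite (trunc_U_a a b) \<and> finite (trunc_U_b a b)"

text \<open>The closed intervals $[l,u]$, $[l,\infty]$ and $[-\infty,u]$ of the projective line.\<close>

definition icc :: "real \<Rightarrow> real \<Rightarrow> rbar set" where
  "icc l u = Fin ` {l..u}"

definition ici :: "real \<Rightarrow> rbar set" where
  "ici l = insert Infty (Fin ` {l..})"

definition iic :: "real \<Rightarrow> rbar set" where
  "iic u = insert Infty (Fin ` {..u})"

definition diagonal :: "(rbar \<times> rbar) set" where
  "diagonal = {(x, y). x = y}"

definition Theta_u :: "real \<Rightarrow> real \<Rightarrow> (rbar \<times> rbar) set" where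
  "Theta_u a b =
     (if b \<ge> 1 then
        iic (- 1) \<times> ici (b - 1) \<union> icc (- 1) 0 \<times> ici (- 1 / a)
      else
        iic (- 1) \<times> ici (b - 1) \<union> icc (- 1) 0 \<times> ici (min (- b / (b - 1)) (- 1 / a))
          \<union> icc 0 1 \<times> ici (- 1 / (b - 1)))"

definition Theta_l :: "real \<Rightarrow> real \<Rightarrow> (rbar \<times> rbar) set" where
  "Theta_l a b =
     (if a \<le> - 1 then
        icc 0 1 \<times> iic (- 1 / b) \<union> ici 1 \<times> iic (a + 1)
      else
        icc (- 1) 0 \<times> iic (- 1 / (a + 1)) \<union> icc 0 1 \<times> iic (max (a / (a + 1)) (- 1 / b))
          \<union> ici 1 \<times> iic (a + 1))"

text \<open>The rectangles of \<^const>\<open>Theta_u\<close> and \<^const>\<open>Theta_l\<close> with two unbounded sides contain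
  the diagonal point $(\infty,\infty)$, which has to be removed.\<close>

definition Theta :: "real \<Rightarrow> real \<Rightarrow> (rbar \<times> rbar) set" where
  "Theta a b = (Theta_u a b \<union> Theta_l a b) - diagonal"

definition attractor_n :: "real \<Rightarrow> real \<Rightarrow> nat \<Rightarrow> (rbar \<times> rbar) set" where
  "attractor_n a b n = (\<Inter>i\<le>n. (F_map a b ^^ i) ` Theta a b)"

definition attractor :: "real \<Rightarrow> real \<Rightarrow> (rbar \<times> rbar) set" where
  "attractor a b = (\<Inter>n. attractor_n a b n)"

text \<open>Lebesgue-almost every point off the diagonal: the points with an infinite coordinate form a
  null set, so only the real plane matters.\<close>

definition almost_every_off_diagonal :: "(rbar \<times> rbar \<Rightarrow> bool) \<Rightarrow> bool" where
  "almost_every_off_diagonal P \<longleftrightarrow>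
     (AE (x, y) in (lborel :: (real \<times> real) measure).
        (Fin x, Fin y) \<notin> diagonal \<longrightarrow> P (Fin x, Fin y))"

end

theory Submission
  imports Defs
begin

text \<open>Each step of \<^const>\<open>F_map\<close> applies one modular transformation to both coordinates, so an orbit of
$F_{a,b}$ is a way of following the geodesic from $x$ to $y$ through the modular surface. The
proof rests on the fact that such a reduction cannot overlook a deep excursion of the geodesic into a
cusp. To say this algebraically, write the pair as $(x, y) = (\gamma X, \gamma Y)$ for a modular
$\gamma$ with bottom row $(C, D)$. A large $|X - Y|$ means that the geodesic goes deeply into the cusp
$\gamma\infty$. Lemma \<open>descent\<close> shows that if $(x, y)$ lies in $\Theta_{a,b}$ and $\gamma\infty$ is
close to $y$, then the orbit of $(x, y)$ passes through a translate $(X + k, Y + k)$ with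
$|X + k| \le 1$; the only way in which the cusp can stop being close to the second coordinate is
to become $\infty$. That this happens at all is a finiteness argument: $|CX + D|$ increases
strictly at every $S$-step, because $|x| > 1$ there, while as long as $C \ne 0$ the pairs $(C, D)$
range over a finite set.

The lemma is used twice. Backwards, it shows that the attractor contains every generic point
$(X, Y)$ with $X$ sufficiently negative and $Y \ge b - 1$ (\<open>far_left_in_attractor\<close>). Following the
geodesic backwards from such a point gives infinitely many points of $\Theta_{a,b}$, and the orbit
of each of them reaches a translate of $(X, Y)$ far up, hence by steps $T^{-1}$ also $(X, Y)$ itself. As
$F_{a,b}$ is finite-to-one, these orbits get arbitrarily long, and as $\Theta_{a,b}$ is invariant, all their
points remain in it. Hence $(X, Y)$ lies in every $F_{a,b}^i(\Theta_{a,b})$.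

Forwards, almost every $y$ has rational approximations $p/q > y$ with $q^2 (p/q - y)$ as small as
desired. For an auxiliary $w$ with $(w, y) \in \Theta_{a,b}$ the geodesic from $w$ to $y$ then has a deep
excursion into the cusp $p/q$, so the orbit of $(w, y)$ sends $y$ to a huge positive number and $w$ to
$[-1, 1]$. The word applied depends on $y$ only, and as soon as $p/q$ is close enough to $y$ and $q$ is
large enough, it sends $x$ to within distance $1$ of the image of $w$. Further
steps $T^{-1}$ carry the image of $(x, y)$ to the far left region just described
(\<open>reach_attractor\<close>).

Genericity excludes a null set: rational $x$, rational $y$, and those $y$ that are modular images of $a$
or $b$, so that no orbit ever meets a discontinuity.\<close>

section \<open>Almost every real has very good rational approximations from above\<close>

text \<open>A measurable set that leaves, at arbitrarily small scales around each of its points, a fixed proportion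
of the neighbourhood uncovered is null. Enclose the set in an open set of almost the same
measure; by Vitali's theorem disjoint balls inside that open set cover almost all of it, and their
holes would occupy too much measure outside the set.\<close>

lemma porous_set_negligible_aux:
  fixes S :: "real set"
  assumes S: "S \<in> lmeasurable" and "\<eta> > 0"
    and por: "\<And>x d. \<lbrakk>x \<in> S; 0 < d\<rbrakk> \<Longrightarrow>
      \<exists>r s t. 0 < r \<and> r < d \<and> {s<..<t} \<subseteq> ball x r - S \<and> \<eta> * r \<le> t - s"
  shows "negligible S"
proof (rule ccontr)
  assume "\<not> negligible S"
  define m where "m = measure lebesgue S"
  have "m > 0"
    using S \<open>\<not> negligible S\<close> by (simp add: m_def negligible_iff_measure zero_less_measure_iff)
  have emS: "emeasure lebesgue S = ennreal m"
    unfolding m_def using S by (simp add: emeasure_eq_measure2)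
  obtain U where U: "open U" "S \<subseteq> U" "U - S \<in> lmeasurable"
    and small: "emeasure lebesgue (U - S) < ennreal (\<eta> / 2 * m)"
    using sets_lebesgue_outer_open[of S "\<eta> / 2 * m"] S \<open>m > 0\<close> \<open>\<eta> > 0\<close> fmeasurableD by auto
  define K where "K = {(x, r, s, t). 0 < r \<and> ball x r \<subseteq> U \<and> {s<..<t} \<subseteq> ball x r - S \<and> \<eta> * r \<le> t - s}"
  obtain C where C: "countable C" "C \<subseteq> K"
    and disj: "pairwise (\<lambda>i j. disjnt (ball (fst i) (fst (snd i))) (ball (fst j) (fst (snd j)))) C"
    and cov: "negligible (S - (\<Union>i\<in>C. ball (fst i) (fst (snd i))))"
  proof (rule Vitali_covering_theorem_balls[of S K fst "\<lambda>i. fst (snd i)"])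
    fix x d :: real assume x: "x \<in> S" "0 < d"
    obtain e where "e > 0" "ball x e \<subseteq> U"
      using U x open_contains_ball by (metis subsetD)
    moreover obtain r s t where "0 < r" "r < min d e" "{s<..<t} \<subseteq> ball x r - S" "\<eta> * r \<le> t - s"
      using por[of x "min d e"] x \<open>e > 0\<close> by auto
    ultimately have "(x, r, s, t) \<in> K"
      unfolding K_def using subset_ball[of r e x] by auto
    then show "\<exists>i. i \<in> K \<and> x \<in> ball (fst i) (fst (snd i)) \<and> fst (snd i) < d"
      using \<open>r < min d e\<close> \<open>0 < r\<close> by force
  qed
  define B where "B i = ball (fst i) (fst (snd i))" for i :: "real \<times> real \<times> real \<times> real"
  define H where "H i = {fst (snd (snd i))<..<snd (snd (snd i))}" for i :: "real \<times> real \<times> real \<times> real"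
  have HB: "H i \<subseteq> B i - S" and BU: "B i \<subseteq> U"
    and size: "ennreal (\<eta> / 2) * emeasure lebesgue (B i) \<le> emeasure lebesgue (H i)" if "i \<in> C" for i
  proof -
    obtain x r s t where i: "i = (x, r, s, t)" by (cases i) auto
    have *: "0 < r" "ball x r \<subseteq> U" "{s<..<t} \<subseteq> ball x r - S" "\<eta> * r \<le> t - s"
      using that C(2) unfolding i K_def by auto
    show "H i \<subseteq> B i - S" "B i \<subseteq> U" using * by (auto simp: H_def B_def i)
    have "s \<le> t" using * \<open>\<eta> > 0\<close> by (smt (verit) mult_pos_pos)
    have "emeasure lebesgue (B i) = ennreal (2 * r)"
      using * by (simp add: B_def i ball_eq_greaterThanLessThan)
    moreover have "emeasure lebesgue (H i) = ennreal (t - s)"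
      using \<open>s \<le> t\<close> by (simp add: H_def i)
    ultimately show "ennreal (\<eta> / 2) * emeasure lebesgue (B i) \<le> emeasure lebesgue (H i)"
      using * \<open>\<eta> > 0\<close> by (simp add: ennreal_mult' [symmetric] ennreal_leI)
  qed
  have dB: "disjoint_family_on B C"
    using disj by (auto simp: disjoint_family_on_def pairwise_def disjnt_def B_def)
  have dH: "disjoint_family_on H C"
    unfolding disjoint_family_on_def
  proof (intro ballI impI)
    fix i j assume "i \<in> C" "j \<in> C" "i \<noteq> j"
    then have "B i \<inter> B j = {}" using dB by (auto simp: disjoint_family_on_def)
    then show "H i \<inter> H j = {}" using HB[OF \<open>i \<in> C\<close>] HB[OF \<open>j \<in> C\<close>] by blast
  qed
  have setB: "\<Union>(B ` C) \<in> sets lebesgue"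
    using C(1) by (intro sets.countable_UN'') (auto simp: B_def)
  have null: "S - \<Union>(B ` C) \<in> null_sets lebesgue"
    using cov by (simp add: B_def negligible_iff_null_sets)
  have "emeasure lebesgue S \<le> emeasure lebesgue (\<Union>(B ` C) \<union> (S - \<Union>(B ` C)))"
    by (rule emeasure_mono) (use setB null in \<open>blast+\<close>)
  also have "\<dots> = emeasure lebesgue (\<Union>(B ` C))"
    by (rule emeasure_Un_null_set[OF setB null])
  finally have "emeasure lebesgue S \<le> emeasure lebesgue (\<Union>(B ` C))" .
  then have "ennreal (\<eta> / 2 * m) \<le> ennreal (\<eta> / 2) * emeasure lebesgue (\<Union>(B ` C))"
    using \<open>\<eta> > 0\<close> \<open>m > 0\<close> by (subst ennreal_mult) (simp_all add: emS mult_left_mono)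
  also have "emeasure lebesgue (\<Union>(B ` C)) = (\<integral>\<^sup>+ i. emeasure lebesgue (B i) \<partial>count_space C)"
    by (rule emeasure_UN_countable) (use C(1) dB in \<open>simp_all add: B_def[abs_def]\<close>)
  also have "ennreal (\<eta> / 2) * (\<integral>\<^sup>+ i. emeasure lebesgue (B i) \<partial>count_space C) =
      (\<integral>\<^sup>+ i. ennreal (\<eta> / 2) * emeasure lebesgue (B i) \<partial>count_space C)"
    by (rule nn_integral_cmult[symmetric]) simp
  also have "\<dots> \<le> (\<integral>\<^sup>+ i. emeasure lebesgue (H i) \<partial>count_space C)"
    by (rule nn_integral_mono) (use size in auto)
  also have "\<dots> = emeasure lebesgue (\<Union>(H ` C))"
    by (rule emeasure_UN_countable[symmetric]) (use C(1) dH in \<open>simp_all add: H_def[abs_def]\<close>)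
  also have "\<dots> \<le> emeasure lebesgue (U - S)"
    by (rule emeasure_mono) (use HB BU U(3) in \<open>blast+\<close>)
  finally show False using small by simp
qed

lemma porous_set_negligible:
  fixes S :: "real set"
  assumes S: "S \<in> sets lebesgue" and "\<eta> > 0"
    and por: "\<And>x d. \<lbrakk>x \<in> S; 0 < d\<rbrakk> \<Longrightarrow>
      \<exists>r s t. 0 < r \<and> r < d \<and> {s<..<t} \<subseteq> ball x r - S \<and> \<eta> * r \<le> t - s"
  shows "negligible S"
proof -
  have "negligible (S \<inter> cbox u v)" for u v
  proof (rule porous_set_negligible_aux)
    show "S \<inter> cbox u v \<in> lmeasurable"
      using S fmeasurable_Int_fmeasurable[OF lmeasurable_cbox S] by (simp only: Int_commute)
    show "\<exists>r s t. 0 < r \<and> r < d \<and> {s<..<t} \<subseteq> ball x r - S \<inter> cbox u v \<and> \<eta> * r \<le> t - s"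
      if "x \<in> S \<inter> cbox u v" "0 < d" for x d
      using por[of x d] that by blast
  qed fact
  then show ?thesis
    by (subst negligible_on_intervals) blast
qed

text \<open>The approximations are taken from above because the sign of $p/q - y$ decides whether an
excursion into the cusp $p/q$ sends $y$ to $+\infty$ or to $-\infty$.\<close>

definition approx_above :: "real \<Rightarrow> real \<Rightarrow> int \<Rightarrow> bool" where
  "approx_above y \<epsilon> q0 \<longleftrightarrow> (\<exists>p q. coprime p q \<and> q0 \<le> q \<and> 0 < q \<and>
     y < of_int p / of_int q \<and> of_int p / of_int q < y + \<epsilon> / (of_int q)\<^sup>2)"

text \<open>The exceptional set is porous: Dirichlet's theorem gives fractions $h/k$ with arbitrarily large $k$ at
distance less than $1/k^2$ from $y$, and the interval of length $\epsilon/k^2$ below $h/k$ is a hole of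
comparable size.\<close>

lemma negligible_not_approx_above:
  assumes "0 < \<epsilon>" "\<epsilon> \<le> 1"
  shows "negligible {y. y \<notin> \<rat> \<and> \<not> approx_above y \<epsilon> q0}"
proof (rule porous_set_negligible)
  let ?I = "\<lambda>(p::int, q::int). {of_int p / of_int q - \<epsilon> / (of_int q)\<^sup>2 <..< of_int p / of_int q :: real}"
  let ?A = "{(p, q). coprime p q \<and> q0 \<le> q \<and> 0 < (q::int)}"
  have eq: "{y. y \<notin> \<rat> \<and> \<not> approx_above y \<epsilon> q0} = - (\<Union> (?I ` ?A)) - \<rat>"
    unfolding approx_above_def by (auto simp: algebra_simps)
  have "open (\<Union> (?I ` ?A))" by (auto intro!: open_UN)
  then have "- (\<Union> (?I ` ?A)) \<in> sets lebesgue"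
    by (intro sets_completionI_sets) (simp only: sets_lborel borel_comp borel_open)
  moreover have "(\<rat> :: real set) \<in> sets lborel"
    by (rule sets.countable[OF _ countable_rat]) simp
  ultimately show "{y. y \<notin> \<rat> \<and> \<not> approx_above y \<epsilon> q0} \<in> sets lebesgue"
    unfolding eq using sets.Diff sets_completionI_sets by blast
  show "0 < \<epsilon> / 2" using assms by simp
  fix y d :: real
  assume y: "y \<in> {y. y \<notin> \<rat> \<and> \<not> approx_above y \<epsilon> q0}" and "0 < d"
  define n where "n = max \<lceil>2 / d\<rceil> q0 + 1"
  \<comment> \<open>For bounded denominators only finitely many numerators occur, so one of the infinitely many
    fractions of Dirichlet's theorem has a denominator exceeding the bound.\<close>
  define W where "W = (\<lambda>k. {\<lfloor>of_int k * y\<rfloor> - 1 .. \<lfloor>of_int k * y\<rfloor> + 2} \<times> {k})"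
  have "infinite (approx_set y)" using y rational_iff_finite_approx_set by auto
  moreover have "finite (\<Union> (W ` {1..n}))" by (auto simp: W_def)
  ultimately obtain h k where hk: "(h, k) \<in> approx_set y" "(h, k) \<notin> \<Union> (W ` {1..n})"
    by (metis finite_subset subrelI)
  then have k: "k > 0" "coprime h k" and close: "\<bar>y - of_int h / of_int k\<bar> < 1 / (of_int k)\<^sup>2"
    by (auto simp: approx_set_def)
  have "k > n"
  proof (rule ccontr)
    assume "\<not> k > n"
    have "\<bar>of_int k * y - of_int h\<bar> = of_int k * \<bar>y - of_int h / of_int k\<bar>"
      using k by (simp add: abs_mult_pos' [symmetric] field_simps)
    also have "\<dots> < of_int k * (1 / (of_int k)\<^sup>2)" using close k by (intro mult_strict_left_mono) auto
    also have "\<dots> \<le> 1" using k by (simp add: power2_eq_square field_simps)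
    finally have "\<bar>of_int k * y - of_int h\<bar> < 1" .
    then have "h \<in> {\<lfloor>of_int k * y\<rfloor> - 1 .. \<lfloor>of_int k * y\<rfloor> + 2}"
      by simp linarith
    then show False using hk(2) \<open>\<not> k > n\<close> k by (auto simp: W_def)
  qed
  then have kb: "k \<ge> q0" "of_int k > 2 / d" by (auto simp: n_def) linarith
  define c r :: real where "c = of_int h / of_int k" and "r = 1 / (of_int k)\<^sup>2"
  have r: "0 < r" using k by (simp add: r_def)
  have "r \<le> 1 / of_int k" using k by (simp add: r_def power2_eq_square field_simps)
  also have "\<dots> < d / 2" using kb k \<open>0 < d\<close> by (simp add: field_simps)
  finally have rd: "2 * r < d" by simp
  have cr: "\<bar>y - c\<bar> < r" using close by (simp add: c_def r_def)
  have er: "\<epsilon> * r \<le> r" using assms r by simp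
  have "{c - \<epsilon> * r<..<c} \<subseteq> ball y (2 * r)"
    using cr er by (auto simp: dist_real_def)
  moreover have "approx_above z \<epsilon> q0" if "z \<in> {c - \<epsilon> * r<..<c}" for z
    unfolding approx_above_def
    by (rule exI[of _ h], rule exI[of _ k]) (use that k kb in \<open>auto simp: c_def r_def\<close>)
  ultimately show "\<exists>r s t. 0 < r \<and> r < d \<and>
      {s<..<t} \<subseteq> ball y r - {y. y \<notin> \<rat> \<and> \<not> approx_above y \<epsilon> q0} \<and> \<epsilon> / 2 * r \<le> t - s"
    using r rd by (intro exI[of _ "2 * r"] exI[of _ "c - \<epsilon> * r"] exI[of _ c]) auto
qed

definition well_approx_above :: "real \<Rightarrow> bool" where
  "well_approx_above y \<longleftrightarrow> (\<forall>\<epsilon>>0. \<forall>q0. approx_above y \<epsilon> q0)"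

lemma negligible_not_well_approx_above:
  "negligible {y. y \<notin> \<rat> \<and> \<not> well_approx_above y}"
  unfolding well_approx_above_def
proof (rule negligible_subset)
  show "negligible (\<Union>n::nat. \<Union>q0. {y. y \<notin> \<rat> \<and> \<not> approx_above y (1 / (real n + 1)) q0})"
  proof (rule negligible_Union_nat)
    show "negligible (\<Union>q0. {y. y \<notin> \<rat> \<and> \<not> approx_above y (1 / (real n + 1)) q0})" for n
      by (intro negligible_countable_Union) (auto intro!: negligible_not_approx_above simp: image_iff)
  qed
  show "{y. y \<notin> \<rat> \<and> \<not> (\<forall>\<epsilon>>0. \<forall>q0. approx_above y \<epsilon> q0)}
      \<subseteq> (\<Union>n::nat. \<Union>q0. {y. y \<notin> \<rat> \<and> \<not> approx_above y (1 / (real n + 1)) q0})"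
  proof
    fix y assume "y \<in> {y. y \<notin> \<rat> \<and> \<not> (\<forall>\<epsilon>>0. \<forall>q0. approx_above y \<epsilon> q0)}"
    then obtain \<epsilon> q0 where y: "y \<notin> \<rat>" "\<epsilon> > 0" "\<not> approx_above y \<epsilon> q0" by blast
    obtain n :: nat where n: "1 / (real n + 1) < \<epsilon>"
      using reals_Archimedean[OF \<open>\<epsilon> > 0\<close>] by (auto simp: inverse_eq_divide add.commute)
    have "approx_above y \<epsilon> q0" if "approx_above y (1 / (real n + 1)) q0"
    proof -
      have "1 / (real n + 1) / x \<le> \<epsilon> / x" if "x > 0" for x :: real
        using n that by (intro divide_right_mono) auto
      then show ?thesis using that unfolding approx_above_def
        by (smt (verit) of_int_0_less_iff zero_less_power)
    qed
    then show "y \<in> (\<Union>n::nat. \<Union>q0. {y. y \<notin> \<rat> \<and> \<not> approx_above y (1 / (real n + 1)) q0})"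
      using y by blast
  qed
qed

section \<open>The modular group on the projective line\<close>

text \<open>The fractional linear transformation with matrix $(A, B; C, D)$. Keeping the integer matrix visible gives access to
the factors $CX + D$, which govern all the distance estimates.\<close>

fun mob :: "int \<Rightarrow> int \<Rightarrow> int \<Rightarrow> int \<Rightarrow> rbar \<Rightarrow> rbar" where
  "mob A B C D (Fin x) =
     (if of_int C * x + of_int D = 0 then Infty
      else Fin ((of_int A * x + of_int B) / (of_int C * x + of_int D)))"
| "mob A B C D Infty = (if C = 0 then Infty else Fin (of_int A / of_int C))"

fun shift :: "int \<Rightarrow> rbar \<Rightarrow> rbar" where
  "shift k (Fin x) = Fin (x + of_int k)"
| "shift k Infty = Infty"

lemma shift_mob: "shift k (mob A B C D z) = mob (A + k * C) (B + k * D) C D z"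
  by (cases z) (auto simp: field_simps)

lemma shift_shift: "shift k (shift l z) = shift (k + l) z"
  by (cases z) auto

lemma shift_0 [simp]: "shift 0 z = z"
  by (cases z) auto

lemma mT_eq_shift: "mT z = shift 1 z"
  by (cases z) auto

lemma mTi_eq_shift: "mTi z = shift (-1) z"
  by (cases z) auto

lemma mS_mS [simp]: "mS (mS z) = z"
  by (cases z) auto

lemma affine_of_fraction: "n \<noteq> 0 \<Longrightarrow> e * (m / n) + f = (e * m + f * n) / n" for e f m n :: real
  by (simp add: add_divide_distrib)

lemma form_nonzero:
  fixes X :: real
  assumes "X \<notin> \<rat>" "(C, D) \<noteq> (0, 0)"
  shows "of_int C * X + of_int D \<noteq> 0"
proof
  assume 0: "of_int C * X + of_int D = 0"
  then have "C \<noteq> 0" using assms(2) by auto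
  then have "X = of_int (- D) / of_int C" using 0 by (simp add: field_simps)
  then show False using assms(1) by (metis Rats_divide Rats_of_int)
qed

lemma det_cast: "A * D - B * C = 1 \<Longrightarrow> real_of_int A * of_int D - of_int B * of_int C = 1"
  by (metis of_int_1 of_int_diff of_int_mult)

lemma det_forms_nonzero:
  fixes X :: real
  assumes "X \<notin> \<rat>" "A * D - B * C = (1::int)"
  shows "of_int C * X + of_int D \<noteq> 0" "of_int A * X + of_int B \<noteq> 0"
proof -
  have "(C, D) \<noteq> (0, 0)" "(A, B) \<noteq> (0, 0)" using assms(2) by auto
  then show "of_int C * X + of_int D \<noteq> 0" "of_int A * X + of_int B \<noteq> 0"
    using form_nonzero[OF assms(1)] by auto
qed

lemma mS_mob:
  assumes det: "A * D - B * C = 1"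
  shows "mS (mob A B C D z) = mob (- C) (- D) A B z"
proof (cases z)
  case (Fin x)
  have "of_int C * x + of_int D = 0 \<Longrightarrow> of_int A * x + of_int B \<noteq> 0"
  proof
    assume *: "of_int C * x + of_int D = 0" "of_int A * x + of_int B = 0"
    have "real_of_int A * of_int D - of_int B * of_int C =
        of_int A * (of_int C * x + of_int D) - of_int C * (of_int A * x + of_int B)"
      by (simp add: algebra_simps)
    then show False using * det_cast[OF det] by simp
  qed
  then show ?thesis unfolding Fin by (auto simp: field_simps)
next
  case Infty
  then show ?thesis using det by (auto simp: field_simps)
qed

text \<open>The distortion formula behind every estimate: $|\gamma X - \gamma Y|\,|CX + D|\,|CY + D| = |X - Y|$.\<close>

lemma mob_diff:
  fixes X Y :: real
  assumes det: "A * D - B * C = 1"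
    and "of_int C * X + of_int D \<noteq> 0" "of_int C * Y + of_int D \<noteq> 0"
  shows "(of_int A * X + of_int B) / (of_int C * X + of_int D)
       - (of_int A * Y + of_int B) / (of_int C * Y + of_int D)
       = (X - Y) / ((of_int C * X + of_int D) * (of_int C * Y + of_int D))"
proof -
  have "(of_int A * X + of_int B) * (of_int C * Y + of_int D)
       - (of_int A * Y + of_int B) * (of_int C * X + of_int D)
      = (of_int A * of_int D - of_int B * of_int C) * (X - Y)"
    by (simp add: algebra_simps)
  then show ?thesis using assms(2,3) det_cast[OF det]
    by (simp add: diff_frac_eq)
qed

lemma mob_irrational:
  fixes X :: real
  assumes "X \<notin> \<rat>" and det: "A * D - B * C = 1"
  shows "(of_int A * X + of_int B) / (of_int C * X + of_int D) \<notin> \<rat>"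
proof
  let ?x = "(of_int A * X + of_int B) / (of_int C * X + of_int D)"
  assume "?x \<in> \<rat>"
  have nz: "of_int C * X + of_int D \<noteq> 0"
    using det_forms_nonzero assms by auto
  have e: "?x * (of_int C * X + of_int D) = of_int A * X + of_int B" using nz by simp
  have "(of_int A - of_int C * ?x) * (of_int C * X + of_int D) =
      of_int A * (of_int C * X + of_int D) - of_int C * (?x * (of_int C * X + of_int D))"
    by (simp only: algebra_simps)
  also have "\<dots> = of_int A * of_int D - of_int B * of_int C"
    unfolding e by (simp add: algebra_simps)
  finally have *: "(of_int A - of_int C * ?x) * (of_int C * X + of_int D) = 1"
    using det_cast[OF det] by simp
  have "X * (of_int A - of_int C * ?x) = of_int D * ?x - of_int B"
  proof -
    have "X * (of_int A - of_int C * ?x) = of_int A * X + of_int B - ?x * (of_int C * X + of_int D) + of_int D * ?x - of_int B"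
      by (simp only: algebra_simps)
    then show ?thesis unfolding e by simp
  qed
  moreover have "of_int A - of_int C * ?x \<noteq> 0" using * by auto
  ultimately have "X = (of_int D * ?x - of_int B) / (of_int A - of_int C * ?x)"
    by (simp add: eq_divide_eq)
  moreover have "(of_int D * ?x - of_int B) / (of_int A - of_int C * ?x) \<in> \<rat>"
    using Rats_divide[OF Rats_diff[OF Rats_mult[OF Rats_of_int \<open>?x \<in> \<rat>\<close>] Rats_of_int]
        Rats_diff[OF Rats_of_int Rats_mult[OF Rats_of_int \<open>?x \<in> \<rat>\<close>]]] .
  ultimately show False using assms(1) by metis
qed

lemma mob_inverse:
  fixes x :: real
  assumes "x \<notin> \<rat>" and det: "A * D - B * C = 1"
  defines "X \<equiv> (of_int D * x - of_int B) / (of_int A - of_int C * x)"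
  shows "of_int A - of_int C * x \<noteq> 0"
    and "of_int C * X + of_int D = 1 / (of_int A - of_int C * x)"
    and "(of_int A * X + of_int B) / (of_int C * X + of_int D) = x"
    and "X \<notin> \<rat>"
proof -
  have det': "D * A - (- B) * (- C) = 1" using det by (simp add: algebra_simps)
  show nz: "of_int A - of_int C * x \<noteq> 0"
    using det_forms_nonzero(1)[OF assms(1) det'] by simp
  have "of_int C * (of_int D * x - of_int B) + of_int D * (of_int A - of_int C * x)
      = of_int A * of_int D - of_int B * of_int C" by (simp add: algebra_simps)
  then show *: "of_int C * X + of_int D = 1 / (of_int A - of_int C * x)"
    using nz det_cast[OF det] unfolding X_def by (subst affine_of_fraction) simp_all
  have "of_int A * (of_int D * x - of_int B) + of_int B * (of_int A - of_int C * x)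
      = (of_int A * of_int D - of_int B * of_int C) * x" by (simp add: algebra_simps)
  then have "of_int A * X + of_int B = x / (of_int A - of_int C * x)"
    using nz det_cast[OF det] unfolding X_def by (subst affine_of_fraction) simp_all
  with * show "(of_int A * X + of_int B) / (of_int C * X + of_int D) = x"
    using nz by simp
  show "X \<notin> \<rat>"
    using mob_irrational[OF assms(1) det'] by (simp add: X_def)
qed

text \<open>Two independent linear forms determine a lattice point, so bounding both leaves finitely many.\<close>

lemma finite_bounded_forms:
  fixes X Y :: real
  assumes "X \<noteq> Y"
  shows "finite {(C, D). \<bar>of_int C * X + of_int D\<bar> \<le> R \<and> \<bar>of_int C * Y + of_int D\<bar> \<le> R'}"
proof -
  define M where "M = (R + R') / \<bar>X - Y\<bar>"
  define M' where "M' = R + M * \<bar>X\<bar>"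
  have "{(C, D). \<bar>of_int C * X + of_int D\<bar> \<le> R \<and> \<bar>of_int C * Y + of_int D\<bar> \<le> R'}
      \<subseteq> {- \<lceil>M\<rceil>..\<lceil>M\<rceil>} \<times> {- \<lceil>M'\<rceil>..\<lceil>M'\<rceil>}"
  proof clarify
    fix C D :: int
    assume *: "\<bar>of_int C * X + of_int D\<bar> \<le> R" "\<bar>of_int C * Y + of_int D\<bar> \<le> R'"
    have "\<bar>of_int C\<bar> * \<bar>X - Y\<bar> = \<bar>(of_int C * X + of_int D) - (of_int C * Y + of_int D)\<bar>"
      by (simp add: abs_mult[symmetric] algebra_simps)
    also have "\<dots> \<le> R + R'" using * by linarith
    finally have C: "\<bar>real_of_int C\<bar> \<le> M" using assms by (simp add: M_def field_simps)
    have "\<bar>real_of_int D\<bar> \<le> R + \<bar>of_int C * X\<bar>" using * by linarith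
    also have "\<dots> \<le> M'" using C by (simp add: M'_def abs_mult mult_right_mono)
    finally have D: "\<bar>real_of_int D\<bar> \<le> M'" .
    show "C \<in> {- \<lceil>M\<rceil>..\<lceil>M\<rceil>} \<and> D \<in> {- \<lceil>M'\<rceil>..\<lceil>M'\<rceil>}"
      using C D by (simp; linarith)
  qed
  then show ?thesis by (rule finite_subset) simp
qed

text \<open>Generic second coordinates: their orbits never meet the discontinuities $a$, $b$, nor $0$ and $\infty$.\<close>

definition generic :: "real \<Rightarrow> real \<Rightarrow> real \<Rightarrow> bool" where
  "generic a b y \<longleftrightarrow> y \<notin> \<rat> \<and> (\<forall>A B C D. A * D - B * C = 1 \<longrightarrow>
     (of_int A * y + of_int B) / (of_int C * y + of_int D) \<notin> {a, b})"

lemma generic_mob: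
  assumes g: "generic a b y" and det: "A * D - B * C = 1"
  shows "generic a b ((of_int A * y + of_int B) / (of_int C * y + of_int D))"
  unfolding generic_def
proof (intro conjI allI impI)
  have y: "y \<notin> \<rat>" using g by (simp add: generic_def)
  show "(of_int A * y + of_int B) / (of_int C * y + of_int D) \<notin> \<rat>"
    by (rule mob_irrational[OF y det])
  fix E F G H :: int assume det': "E * H - F * G = 1"
  let ?n = "of_int C * y + of_int D" and ?m = "of_int A * y + of_int B"
  have nz: "?n \<noteq> 0" using det_forms_nonzero[OF y det] by blast
  have "(E * A + F * C) * (G * B + H * D) - (E * B + F * D) * (G * A + H * C)
      = (E * H - F * G) * (A * D - B * C)" by algebra
  then have det'': "(E * A + F * C) * (G * B + H * D) - (E * B + F * D) * (G * A + H * C) = 1"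
    using det det' by simp
  have "(of_int E * (?m / ?n) + of_int F) = (of_int E * ?m + of_int F * ?n) / ?n"
    "(of_int G * (?m / ?n) + of_int H) = (of_int G * ?m + of_int H * ?n) / ?n"
    by (rule affine_of_fraction[OF nz])+
  then have "(of_int E * (?m / ?n) + of_int F) / (of_int G * (?m / ?n) + of_int H)
      = (of_int E * ?m + of_int F * ?n) / (of_int G * ?m + of_int H * ?n)"
    using nz by simp
  also have "\<dots> = (of_int (E * A + F * C) * y + of_int (E * B + F * D))
       / (of_int (G * A + H * C) * y + of_int (G * B + H * D))"
    by (simp add: algebra_simps)
  finally show "(of_int E * (?m / ?n) + of_int F) / (of_int G * (?m / ?n) + of_int H) \<notin> {a, b}"
    using g det'' unfolding generic_def by metis
qed

lemma generic_shift: "generic a b y \<Longrightarrow> generic a b (y + of_int k)"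
  using generic_mob[of a b y 1 1 k 0] by simp

lemma generic_S: "generic a b y \<Longrightarrow> generic a b (- 1 / y)"
  using generic_mob[of a b y 0 0 "-1" 1] by simp

lemma generic_irrational: "generic a b y \<Longrightarrow> y \<notin> \<rat>"
  by (simp add: generic_def)

lemma generic_neq:
  assumes "generic a b y"
  shows "y \<noteq> a" "y \<noteq> b"
proof -
  have "(of_int 1 * y + of_int 0) / (of_int 0 * y + of_int 1) \<notin> {a, b}"
    using assms unfolding generic_def by (metis mult_1 mult_zero_left diff_zero)
  then show "y \<noteq> a" "y \<noteq> b" by auto
qed

lemma irrational_shift: "(x::real) \<notin> \<rat> \<Longrightarrow> x + of_int k \<notin> \<rat>"
  by (metis Rats_diff Rats_of_int add_diff_cancel_right')

lemma irrational_S: "(x::real) \<notin> \<rat> \<Longrightarrow> - 1 / x \<notin> \<rat>"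
  using mob_irrational[of x 0 0 "-1" 1] by simp

lemma irrational_nz: "(x::real) \<notin> \<rat> \<Longrightarrow> x \<noteq> 0"
  by auto

section \<open>Invariance of the trapping region\<close>

text \<open>Real form of the upper part $\Theta^u_{a,b}$. The reflection $(x, y) \mapsto (-x, -y)$ interchanges the parameters $(a, b)$ and
$(-b, -a)$ and the two parts of $\Theta_{a,b}$, so the lower part needs no separate formula, and every
fact about it follows from the one about the upper part.\<close>

definition Theta_up :: "real \<Rightarrow> real \<Rightarrow> real \<Rightarrow> real \<Rightarrow> bool" where
  "Theta_up a b x y \<longleftrightarrow>
     x \<le> - 1 \<and> b - 1 \<le> y \<or>
     - 1 \<le> x \<and> x \<le> 0 \<and> - 1 / a \<le> y \<or>
     b < 1 \<and> - 1 \<le> x \<and> x \<le> 0 \<and> b / (1 - b) \<le> y \<or>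
     b < 1 \<and> 0 \<le> x \<and> x \<le> 1 \<and> 1 / (1 - b) \<le> y"

definition in_Theta :: "real \<Rightarrow> real \<Rightarrow> real \<Rightarrow> real \<Rightarrow> bool" where
  "in_Theta a b x y \<longleftrightarrow> Theta_up a b x y \<or> Theta_up (- b) (- a) (- x) (- y)"

locale admissible =
  fixes a b :: real
  assumes a_neg: "a < 0" and b_pos: "0 < b" and width: "b - a \<ge> 1" and area: "- a * b \<le> 1"
    and no_corner: "(a, b) \<noteq> (- 1, 1)"

lemma admissible_reflect:
  assumes "admissible a b" shows "admissible (- b) (- a)"
  using assms by (auto simp: admissible_def mult.commute)

context admissible
begin

lemma recip_a: "b \<le> - 1 / a"
  using area a_neg by (simp add: pos_le_minus_divide_eq neg_le_divide_eq field_simps)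

lemma recip_b: "- 1 / b \<le> a"
  using area b_pos by (simp add: field_simps)

text \<open>The corner $(-1, 1)$ has to be excluded exactly here. For $b \ge 1$ the conclusion makes
$(1, \infty) \times (-1, 0)$ a subset of $\Theta_{a,b}$, while for $b < 1$ the set
$(-\infty, -1) \times (0, 1)$ is one; backward orbits visit both sets.\<close>

lemma b_less_1_or: "b < 1 \<or> - 1 < a"
proof (rule ccontr)
  assume "\<not> (b < 1 \<or> - 1 < a)"
  then have ab: "1 \<le> b" "1 \<le> - a" by auto
  then have "b \<le> - a * b" "- a \<le> - a * b"
    using mult_right_mono[of 1 "- a" b] mult_left_mono[of 1 b "- a"] by auto
  then have "b = 1" "a = - 1" using area ab by linarith+
  then show False using no_corner by simp
qed

text \<open>Over $y < b$ only the unbounded rectangle of $\Theta^u_{a,b}$ is present, since the other ones lie above height $b$.\<close>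

lemma up_strip:
  assumes "Theta_up a b x y" "y < b" shows "x \<le> - 1 \<and> b - 1 \<le> y"
proof -
  have "b \<le> b / (1 - b)" if "b < 1" using that b_pos by (simp add: field_simps)
  moreover have "b \<le> 1 / (1 - b)" if "b < 1"
  proof -
    have "b * (1 - b) \<le> 1 * 1" using that b_pos by (intro mult_mono) auto
    then show ?thesis using that by (simp add: field_simps)
  qed
  ultimately show ?thesis using assms recip_a unfolding Theta_up_def by auto
qed

lemma up_ge: "Theta_up a b x y \<Longrightarrow> b - 1 \<le> y"
  using up_strip[of x y] by linarith

lemma up_Ti:
  assumes "Theta_up a b x y" "b \<le> y" shows "Theta_up a b (x - 1) (y - 1)"
proof -
  have "1 / (1 - b) - 1 = b / (1 - b)" if "b < 1" using that by (simp add: field_simps)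
  then have "b < 1 \<Longrightarrow> 1 / (1 - b) \<le> y \<Longrightarrow> b / (1 - b) \<le> y - 1" by linarith
  then show ?thesis using assms unfolding Theta_up_def by auto
qed

lemma up_S:
  assumes "Theta_up a b x y" "y < b" "y \<noteq> 0"
  shows "in_Theta a b (- 1 / x) (- 1 / y)"
proof -
  have x: "x \<le> - 1" and y: "b - 1 \<le> y" using up_strip assms by auto
  have x': "0 \<le> - 1 / x" "- 1 / x \<le> 1" using x by (simp_all add: field_simps)
  show ?thesis
  proof (cases "y > 0")
    case True
    then have "- 1 / y \<le> - 1 / b" using assms(2) b_pos by (simp add: field_simps)
    then show ?thesis using x' unfolding in_Theta_def Theta_up_def by auto
  next
    case False
    then have "y < 0" using assms by simp
    then have "b < 1" using y by simp
    have "1 / (1 - b) \<le> - 1 / y" using y \<open>y < 0\<close> \<open>b < 1\<close> by (simp add: field_simps)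
    then show ?thesis using x' \<open>b < 1\<close> unfolding in_Theta_def Theta_up_def by auto
  qed
qed

end

lemma in_Theta_reflect: "in_Theta (- b) (- a) (- x) (- y) = in_Theta a b x y"
  by (auto simp: in_Theta_def)

context admissible
begin

interpretation mirror: admissible "- b" "- a"
  by (rule admissible_reflect) unfold_locales

lemma in_Theta_T:
  assumes "in_Theta a b x y" "y < a" shows "in_Theta a b (x + 1) (y + 1)"
proof -
  have "\<not> Theta_up a b x y" using up_ge assms width by force
  then have "Theta_up (- b) (- a) (- x) (- y)" using assms by (simp add: in_Theta_def)
  then have "Theta_up (- b) (- a) (- x - 1) (- y - 1)" using mirror.up_Ti assms(2) by simp
  then show ?thesis by (simp add: in_Theta_def)
qed

lemma in_Theta_Ti:
  assumes "in_Theta a b x y" "b < y" shows "in_Theta a b (x - 1) (y - 1)"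
proof -
  have "\<not> Theta_up (- b) (- a) (- x) (- y)" using mirror.up_ge assms width by force
  then have "Theta_up a b x y" using assms by (simp add: in_Theta_def)
  then show ?thesis using up_Ti assms(2) by (simp add: in_Theta_def)
qed

lemma in_Theta_S:
  assumes "in_Theta a b x y" "a < y" "y < b" "y \<noteq> 0"
  shows "in_Theta a b (- 1 / x) (- 1 / y)"
proof (cases "Theta_up a b x y")
  case True then show ?thesis using up_S assms by (simp add: in_Theta_def)
next
  case False
  then have "Theta_up (- b) (- a) (- x) (- y)" using assms(1) by (simp add: in_Theta_def)
  then have "in_Theta (- b) (- a) (- (- 1 / x)) (- (- 1 / y))"
    using mirror.up_S[of "- x" "- y"] assms by simp
  then show ?thesis by (simp only: in_Theta_reflect)
qed

definition gap_const :: real where "gap_const = min (- a) b"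

definition ratio_const :: real where "ratio_const = 1 + max (- a) b / gap_const"

lemma gap_const_pos: "0 < gap_const" using a_neg b_pos by (simp add: gap_const_def)

lemma ratio_const_ge_1: "1 \<le> ratio_const"
  using gap_const_pos b_pos by (simp add: ratio_const_def)

text \<open>The three estimates available at an $S$-step. The first makes $|CX + D|$ grow; the second keeps the
part of $\Theta_{a,b}$ over the strip away from the diagonal; the third prevents the cusp from jumping from the second coordinate
to the first.\<close>

lemma strip_bounds:
  assumes "in_Theta a b x y" "a < y" "y < b"
  shows "1 \<le> \<bar>x\<bar>" "gap_const \<le> \<bar>x - y\<bar>" "\<bar>x\<bar> \<le> ratio_const * \<bar>x - y\<bar>"
proof -
  have "x \<le> - 1 \<and> b - 1 \<le> y \<or> 1 \<le> x \<and> y \<le> a + 1"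
    using assms up_strip[of x y] mirror.up_strip[of "- x" "- y"] by (auto simp: in_Theta_def)
  then show "1 \<le> \<bar>x\<bar>" and gap: "gap_const \<le> \<bar>x - y\<bar>"
    using assms by (auto simp: gap_const_def)
  have "\<bar>x\<bar> \<le> \<bar>x - y\<bar> + max (- a) b" using assms by linarith
  also have "max (- a) b = max (- a) b / gap_const * gap_const" using gap_const_pos by simp
  also have "\<dots> \<le> max (- a) b / gap_const * \<bar>x - y\<bar>"
    using gap gap_const_pos b_pos by (intro mult_left_mono) auto
  finally show "\<bar>x\<bar> \<le> ratio_const * \<bar>x - y\<bar>" by (simp add: ratio_const_def algebra_simps)
qed

lemma in_Theta_imp_Theta:
  assumes "in_Theta a b x y" "x \<noteq> y" shows "(Fin x, Fin y) \<in> Theta a b"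
proof -
  have 1: "(Fin x, Fin y) \<in> Theta_u a b" if "Theta_up a b x y"
  proof (cases "1 \<le> b")
    case True
    with that show ?thesis by (auto simp: Theta_up_def Theta_u_def icc_def ici_def iic_def)
  next
    case False
    have "- b / (b - 1) = b / (1 - b)" "- 1 / (b - 1) = 1 / (1 - b)"
      using minus_divide_divide[of b "1 - b"] minus_divide_divide[of 1 "1 - b"] by simp_all
    with that False show ?thesis
      unfolding Theta_u_def by (auto simp: Theta_up_def icc_def ici_def iic_def min_le_iff_disj)
  qed
  have 2: "(Fin x, Fin y) \<in> Theta_l a b" if "Theta_up (- b) (- a) (- x) (- y)"
  proof (cases "a \<le> - 1")
    case True
    with that show ?thesis by (auto simp: Theta_up_def Theta_l_def icc_def ici_def iic_def)
  next
    case False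
    then have "- a / (1 + a) \<le> - y \<longleftrightarrow> y \<le> a / (a + 1)" "1 / (1 + a) \<le> - y \<longleftrightarrow> y \<le> - 1 / (a + 1)"
      by (auto simp: add.commute)
    with that False show ?thesis
      unfolding Theta_l_def by (auto simp: Theta_up_def icc_def ici_def iic_def le_max_iff_disj)
  qed
  from 1 2 assms show ?thesis by (auto simp: in_Theta_def Theta_def diagonal_def)
qed

abbreviation F :: "rbar \<times> rbar \<Rightarrow> rbar \<times> rbar" where "F \<equiv> F_map a b"

abbreviation gen :: "real \<Rightarrow> bool" where "gen \<equiv> generic a b"

lemma F_T: "y < a \<Longrightarrow> F (z, Fin y) = (shift 1 z, Fin (y + 1))"
  by (simp add: mT_eq_shift)

lemma F_Ti: "b \<le> y \<Longrightarrow> F (z, Fin y) = (shift (- 1) z, Fin (y - 1))"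
  using a_neg b_pos by (simp add: mTi_eq_shift)

lemma F_S: "a \<le> y \<Longrightarrow> y < b \<Longrightarrow> y \<noteq> 0 \<Longrightarrow> F (z, Fin y) = (mS z, Fin (- 1 / y))"
  by simp

text \<open>Restricting $\Theta_{a,b}$ to generic points keeps orbits off the discontinuities, so that invariance
requires no care at the boundary.\<close>

definition gen_Theta :: "(rbar \<times> rbar) set" where
  "gen_Theta = {(Fin x, Fin y) | x y. x \<notin> \<rat> \<and> gen y \<and> x \<noteq> y \<and> in_Theta a b x y}"

lemma gen_Theta_subset: "gen_Theta \<subseteq> Theta a b"
  using in_Theta_imp_Theta by (auto simp: gen_Theta_def)

lemma F_gen_Theta:
  assumes "p \<in> gen_Theta" shows "F p \<in> gen_Theta"
proof -
  obtain x y where p: "p = (Fin x, Fin y)" and xy: "x \<notin> \<rat>" "gen y" "x \<noteq> y" "in_Theta a b x y"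
    using assms by (auto simp: gen_Theta_def)
  have nz: "x \<noteq> 0" "y \<noteq> 0" using xy irrational_nz generic_irrational by blast+
  consider "y < a" | "a < y" "y < b" | "b < y"
    using generic_neq[OF xy(2)] by linarith
  then show ?thesis
  proof cases
    case 1
    then show ?thesis
      using xy in_Theta_T irrational_shift[of x 1] generic_shift[of a b y 1]
      by (simp add: p F_T gen_Theta_def del: F_map.simps)
  next
    case 2
    then have "F p = (Fin (- 1 / x), Fin (- 1 / y))" using nz by (simp add: p)
    then show ?thesis
      using 2 xy nz in_Theta_S irrational_S generic_S by (simp add: gen_Theta_def)
  next
    case 3
    then show ?thesis
      using xy in_Theta_Ti irrational_shift[of x "-1"] generic_shift[of a b y "-1"]
      by (simp add: p F_Ti gen_Theta_def del: F_map.simps)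
  qed
qed

lemma funpow_F_gen_Theta: "p \<in> gen_Theta \<Longrightarrow> (F ^^ n) p \<in> gen_Theta"
  by (induction n) (auto intro: F_gen_Theta simp del: F_map.simps)

text \<open>By invariance, a point that ends orbits of length $N \ge i$ starting in $\Theta_{a,b}$ has an $i$-th preimage in
$\Theta_{a,b}$, namely the point of such an orbit $i$ steps earlier.\<close>

lemma attractorI:
  assumes "\<And>n. \<exists>q\<in>gen_Theta. \<exists>N\<ge>n. (F ^^ N) q = p"
  shows "p \<in> attractor a b"
proof -
  have "p \<in> (F ^^ i) ` Theta a b" for i
  proof -
    obtain q N where q: "q \<in> gen_Theta" "i \<le> N" "(F ^^ N) q = p" using assms by blast
    then have "(F ^^ i) ((F ^^ (N - i)) q) = p"
      by (metis comp_apply funpow_add le_add_diff_inverse)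
    moreover have "(F ^^ (N - i)) q \<in> Theta a b"
      using funpow_F_gen_Theta gen_Theta_subset q by blast
    ultimately show ?thesis by blast
  qed
  then show ?thesis by (auto simp: attractor_def attractor_n_def)
qed

lemma finite_F_preimage: "finite {w. F w = z}"
proof -
  obtain z1 z2 where z: "z = (z1, z2)" by (cases z)
  have "w \<in> {(mTi z1, mTi z2), (mT z1, mT z2), (mS z1, mS z2)}" if "F w = z" for w
  proof -
    obtain w1 w2 where w: "w = (w1, w2)" by (cases w)
    have "branch a b w2 \<in> {mT, mS, mTi}" by (cases w2) auto
    then show ?thesis using that unfolding w z
      by (auto simp: mT_eq_shift mTi_eq_shift shift_shift)
  qed
  then have "{w. F w = z} \<subseteq> {(mTi z1, mTi z2), (mT z1, mT z2), (mS z1, mS z2)}" by blast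
  then show ?thesis by (rule finite_subset) simp
qed

lemma finite_funpow_F_preimage: "finite {w. (F ^^ n) w = z}"
proof (induction n)
  case (Suc n)
  have "{w. (F ^^ Suc n) w = z} = (\<Union>v\<in>{v. (F ^^ n) v = z}. {w. F w = v})"
    by (auto simp: funpow_swap1)
  then show ?case using Suc finite_F_preimage by (auto simp del: F_map.simps)
qed simp

lemma funpow_shift_down:
  assumes "b - 1 \<le> Y"
  shows "(F ^^ n) (shift (int n) z, Fin (Y + n)) = (z, Fin Y)"
proof (induction n)
  case (Suc n)
  have "(F ^^ Suc n) (shift (int (Suc n)) z, Fin (Y + Suc n))
      = (F ^^ n) (F (shift (int (Suc n)) z, Fin (Y + Suc n)))"
    by (simp add: funpow_swap1 del: F_map.simps)
  also have "F (shift (int (Suc n)) z, Fin (Y + Suc n)) = (shift (int n) z, Fin (Y + n))"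
    using assms by (subst F_Ti) (auto simp: shift_shift)
  finally show ?case using Suc by simp
qed simp

text \<open>Because $b - a \ge 1$, the translations cannot jump over the interval $(a, b)$. The word depends on $y$ only, so it
acts in the same way on every first coordinate $z$.\<close>

lemma reach_strip:
  assumes "gen y" "in_Theta a b x y"
  shows "\<exists>n k. a < y + of_int k \<and> y + of_int k < b \<and> in_Theta a b (x + of_int k) (y + of_int k)
      \<and> (\<forall>z. (F ^^ n) (z, Fin y) = (shift k z, Fin (y + of_int k)))"
proof -
  have "gen y \<Longrightarrow> in_Theta a b x y \<Longrightarrow> a - real m < y \<Longrightarrow> y < b + real m \<Longrightarrow> ?thesis" for m
  proof (induction m arbitrary: x y)
    case 0
    show ?case by (rule exI[of _ 0], rule exI[of _ 0]) (use 0 in simp)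
  next
    case (Suc m)
    have step: ?case if e: "in_Theta a b (x + of_int e) (y + of_int e)" "a - real m < y + of_int e"
      "y + of_int e < b + real m" "\<And>z. F (z, Fin y) = (shift e z, Fin (y + of_int e))" for e
    proof -
      obtain n k where k: "a < y + of_int e + of_int k" "y + of_int e + of_int k < b"
        "in_Theta a b (x + of_int e + of_int k) (y + of_int e + of_int k)"
        "\<And>z. (F ^^ n) (z, Fin (y + of_int e)) = (shift k z, Fin (y + of_int e + of_int k))"
        using Suc.IH[OF generic_shift[OF Suc.prems(1)] e(1-3)] by blast
      have "(F ^^ Suc n) (z, Fin y) = (shift (e + k) z, Fin (y + of_int (e + k)))" for z
        using k(4) e(4) by (simp add: funpow_swap1 shift_shift add.commute add.left_commute del: F_map.simps)
      then show ?thesis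
        using k(1-3) by (intro exI[of _ "Suc n"] exI[of _ "e + k"]) (simp add: add.assoc del: F_map.simps funpow.simps)
    qed
    consider "y < a" | "a < y" "y < b" | "b < y"
      using generic_neq[OF Suc.prems(1)] by linarith
    then show ?case
    proof cases
      case 1
      then show ?thesis using Suc.prems width in_Theta_T[of x y]
        by (intro step[of 1]) (auto simp: F_T simp del: F_map.simps)
    next
      case 2
      then show ?thesis using Suc.prems
        by (intro exI[of _ 0]) simp
    next
      case 3
      then show ?thesis using Suc.prems width in_Theta_Ti[of x y]
        by (intro step[of "-1"]) (auto simp: F_Ti simp del: F_map.simps)
    qed
  qed
  moreover obtain m where "\<bar>a\<bar> + \<bar>b\<bar> + \<bar>y\<bar> < real m" using reals_Archimedean2 by blast
  ultimately show ?thesis using assms by (smt (verit))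
qed

section \<open>Deep cusp excursions are seen by the orbit\<close>

text \<open>Set $u = |CX + D|$ and $v = |CY + D|$. Then $u v |x - y| = |X - Y|$, and $u + v \ge |C|\,|X - Y|$, so for
$C \ne 0$ one of $u$, $v$ is at least $|X - Y| / 2$; a large $v$ says that the cusp $\gamma\infty = A / C$ is close
to $y$, because $|y - A/C| = 1 / (|C| v)$. An $S$-step multiplies $u$ by $|x|$ and $v$ by $|y|$. If $v$ is large before the step,
then $|x|\,u \le 2 |x| / |x - y|$ is bounded, so $v$ is again large after it, unless the cusp has become
$\infty$, which ends the descent. Meanwhile $u$ increases at every $S$-step and both $u$ and $v$ stay bounded,
so that only finitely many bottom rows $(C, D)$ are available.

The conclusion holds for every first coordinate $z$: later $z = X$ locates the orbit, $z = \infty$ tells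
the starting points apart, and $z$ near $X$ follows a nearby geodesic.\<close>

lemma descent_strip:
  fixes X Y :: real
  assumes X: "X \<notin> \<rat>" and Y: "gen Y" and big: "4 * ratio_const < \<bar>X - Y\<bar>" and "0 < u0"
    and "A * D - B * C = 1" and "C \<noteq> 0"
    and "x = (of_int A * X + of_int B) / (of_int C * X + of_int D)"
    and "y = (of_int A * Y + of_int B) / (of_int C * Y + of_int D)"
    and "in_Theta a b x y" "a < y" "y < b"
    and "\<bar>X - Y\<bar> / 2 \<le> \<bar>of_int C * Y + of_int D\<bar>"
    and "u0 \<le> \<bar>of_int C * X + of_int D\<bar>"
  shows "\<exists>N k. (\<forall>z. (F ^^ N) (mob A B C D z, Fin y) = (shift k z, Fin (Y + of_int k)))
      \<and> \<bar>X + of_int k\<bar> \<le> 1 \<and> \<bar>X - Y\<bar> / 2 \<le> \<bar>Y + of_int k\<bar>"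
proof -
  define L where "L = \<bar>X - Y\<bar>"
  have Lpos: "0 < L" using big ratio_const_ge_1 by (simp add: L_def)
  \<comment> \<open>All bottom rows that can occur at later visits to the strip. The bound
    on $v$ uses that $u$ never drops below its initial value.\<close>
  define Z where "Z = {(c, e). \<bar>of_int c * X + of_int e\<bar> \<le> 2 / gap_const
      \<and> \<bar>of_int c * Y + of_int e\<bar> \<le> L / (u0 * gap_const)}"
  have finZ: "finite Z"
    unfolding Z_def by (rule finite_bounded_forms) (use Lpos in \<open>auto simp: L_def\<close>)
  define later where "later c e = {(c', e') \<in> Z. \<bar>of_int c * X + of_int e\<bar> < \<bar>of_int c' * X + of_int e'\<bar>}" for c e :: int
  show ?thesis
    using assms(5-13)
  proof (induction "card (later C D)" arbitrary: A B C D x y rule: less_induct)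
    case less
    note det = less.prems(1)
    define u v where "u = \<bar>of_int C * X + of_int D\<bar>" and "v = \<bar>of_int C * Y + of_int D\<bar>"
    have Yirr: "Y \<notin> \<rat>" using Y generic_irrational by blast
    have nz: "of_int C * X + of_int D \<noteq> 0" "of_int A * X + of_int B \<noteq> 0"
      "of_int C * Y + of_int D \<noteq> 0" "of_int A * Y + of_int B \<noteq> 0"
      using det_forms_nonzero[OF X det] det_forms_nonzero[OF Yirr det] by auto
    have upos: "0 < u" "0 < v" using nz by (auto simp: u_def v_def)
    have x: "x = (of_int A * X + of_int B) / (of_int C * X + of_int D)"
      and y: "y = (of_int A * Y + of_int B) / (of_int C * Y + of_int D)"
      and str: "in_Theta a b x y" "a < y" "y < b" and v: "L / 2 \<le> v" and u: "u0 \<le> u"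
      using less.prems by (auto simp: u_def v_def L_def)
    have irr: "x \<notin> \<rat>" unfolding x by (rule mob_irrational[OF X det])
    have geny: "gen y" unfolding y by (rule generic_mob[OF Y det])
    have nzxy: "x \<noteq> 0" "y \<noteq> 0" using irr geny irrational_nz generic_irrational by blast+
    have prod: "\<bar>x - y\<bar> * (u * v) = L"
    proof -
      have "x - y = (X - Y) / ((of_int C * X + of_int D) * (of_int C * Y + of_int D))"
        unfolding x y by (rule mob_diff[OF det nz(1) nz(3)])
      then show ?thesis using nz by (simp add: L_def u_def v_def abs_mult)
    qed
    note sb = strip_bounds[OF str]
    have xy0: "0 < \<bar>x - y\<bar>" using sb(2) gap_const_pos by linarith
    have xu: "\<bar>x - y\<bar> * u \<le> 2"
    proof -
      have "\<bar>x - y\<bar> * u * (L / 2) \<le> \<bar>x - y\<bar> * u * v"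
        using v xy0 upos by (intro mult_left_mono) auto
      also have "\<dots> = L" using prod by (simp add: mult.assoc)
      finally show ?thesis using Lpos by (simp add: field_simps)
    qed
    have u': "\<bar>of_int A * X + of_int B\<bar> = \<bar>x\<bar> * u" and v': "\<bar>of_int A * Y + of_int B\<bar> = \<bar>y\<bar> * v"
      using nz by (auto simp: x y u_def v_def)
    have mobS: "(F ^^ 1) (mob A B C D z, Fin y) = (mob (- C) (- D) A B z, Fin (- 1 / y))" for z
      using F_S[of y] str nzxy mS_mob[OF det] by simp
    show ?case
    \<comment> \<open>The bottom row after the $S$-step is $(A, B)$; for $A = 0$ the remaining transformation is a translation.\<close>
    proof (cases "A = 0")
      case True
      then have BC: "- B * C = 1" using det by simp
      then have CB: "C = 1 \<and> B = - 1 \<or> C = - 1 \<and> B = 1"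
        by (metis minus_mult_commute mult_minus_left neg_equal_iff_equal zmult_eq_1_iff minus_minus)
      have sh: "mob (- C) (- D) A B z = shift (C * D) z" for z
        using CB True by (cases z) (auto simp: field_simps)
      have Sx: "- 1 / x = X + of_int (C * D)" and Sy: "- 1 / y = Y + of_int (C * D)"
        using CB True nz by (auto simp: x y field_simps)
      have "\<bar>X + of_int (C * D)\<bar> \<le> 1"
        unfolding Sx[symmetric] using sb(1) by (simp add: field_simps)
      moreover have "\<bar>Y + of_int (C * D)\<bar> = v"
        using CB by (auto simp: v_def)
      ultimately show ?thesis
        using mobS v unfolding sh Sy L_def by metis
    next
      case False
      have sum: "L \<le> \<bar>x\<bar> * u + \<bar>y\<bar> * v"
      proof -
        have "1 * L \<le> \<bar>of_int A\<bar> * L" using False Lpos by (intro mult_right_mono) auto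
        also have "\<bar>of_int A\<bar> * L = \<bar>(of_int A * X + of_int B) - (of_int A * Y + of_int B)\<bar>"
          by (simp add: L_def abs_mult[symmetric] algebra_simps)
        also have "\<dots> \<le> \<bar>x\<bar> * u + \<bar>y\<bar> * v" using u' v' by linarith
        finally show ?thesis by simp
      qed
      have "\<bar>x\<bar> * u \<le> (ratio_const * \<bar>x - y\<bar>) * u" using sb(3) upos by (intro mult_right_mono) auto
      also have "\<dots> \<le> ratio_const * 2"
        unfolding mult.assoc using xu ratio_const_ge_1 by (intro mult_left_mono) auto
      also have "\<dots> < L / 2" using big by (simp add: L_def)
      finally have newv: "L / 2 \<le> \<bar>of_int A * Y + of_int B\<bar>" using sum unfolding v' by linarith
      have "\<bar>x\<bar> \<noteq> 1" using irr by (auto simp: abs_if split: if_splits)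
      then have "1 < \<bar>x\<bar>" using sb(1) by linarith
      then have newu: "u < \<bar>of_int A * X + of_int B\<bar>" using upos unfolding u' by simp
      have "in_Theta a b (- 1 / x) (- 1 / y)" using in_Theta_S str nzxy by blast
      then obtain n k where k: "a < - 1 / y + of_int k" "- 1 / y + of_int k < b"
        "in_Theta a b (- 1 / x + of_int k) (- 1 / y + of_int k)"
        "\<And>z. (F ^^ n) (z, Fin (- 1 / y)) = (shift k z, Fin (- 1 / y + of_int k))"
        using reach_strip[OF generic_S[OF geny]] by blast
      \<comment> \<open>The matrix and the point at the next visit to the strip; the bottom row is unaffected by translations.\<close>
      define A' B' x' y' where "A' = - C + k * A" and "B' = - D + k * B"
        and "x' = - 1 / x + of_int k" and "y' = - 1 / y + of_int k"
      have det': "A' * B - B' * A = 1" using det by (simp add: A'_def B'_def algebra_simps)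
      have x': "x' = (of_int A' * X + of_int B') / (of_int A * X + of_int B)"
        and y': "y' = (of_int A' * Y + of_int B') / (of_int A * Y + of_int B)"
        using nz by (auto simp: x'_def y'_def x y A'_def B'_def field_simps)
      note str' = k(3,1,2)[folded x'_def y'_def]
      have iter: "(F ^^ (n + 1)) (mob A B C D z, Fin y) = (mob A' B' A B z, Fin y')" for z
      proof -
        have "(F ^^ (n + 1)) (mob A B C D z, Fin y) = (F ^^ n) (mob (- C) (- D) A B z, Fin (- 1 / y))"
          unfolding funpow_add comp_apply mobS ..
        then show ?thesis unfolding k(4) by (simp add: shift_mob A'_def B'_def y'_def)
      qed
      define u2 v2 where "u2 = \<bar>of_int A * X + of_int B\<bar>" and "v2 = \<bar>of_int A * Y + of_int B\<bar>"
      have pos2: "0 < u2" "0 < v2" using nz by (auto simp: u2_def v2_def)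
      have prod2: "\<bar>x' - y'\<bar> * (u2 * v2) = L"
      proof -
        have "x' - y' = (X - Y) / ((of_int A * X + of_int B) * (of_int A * Y + of_int B))"
          unfolding x' y' by (rule mob_diff[OF det' nz(2) nz(4)])
        then show ?thesis using nz by (simp add: L_def u2_def v2_def abs_mult)
      qed
      have gap2: "gap_const \<le> \<bar>x' - y'\<bar>" using strip_bounds[OF str'] by blast
      have bound2: "gap_const * (u2 * v2) \<le> L"
        using mult_right_mono[OF gap2, of "u2 * v2"] pos2 prod2 by simp
      have "(A, B) \<in> Z"
      proof -
        have "gap_const * u2 * (L / 2) \<le> gap_const * u2 * v2"
          using newv gap_const_pos pos2 by (intro mult_left_mono) (auto simp: v2_def)
        then have "gap_const * u2 * (L / 2) \<le> L" using bound2 by (simp add: mult.assoc)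
        then have "u2 \<le> 2 / gap_const" using Lpos gap_const_pos by (simp add: field_simps)
        moreover have "u0 * gap_const * v2 \<le> u2 * gap_const * v2"
          using u newu pos2 gap_const_pos by (intro mult_right_mono) (auto simp: u2_def)
        then have "v2 * (u0 * gap_const) \<le> L" using bound2 by (simp add: algebra_simps)
        then have "v2 \<le> L / (u0 * gap_const)"
          using \<open>0 < u0\<close> gap_const_pos by (simp add: pos_le_divide_eq)
        ultimately show ?thesis by (simp add: Z_def u2_def v2_def)
      qed
      then have "(A, B) \<in> later C D" "(A, B) \<notin> later A B"
        using newu by (auto simp: later_def u_def)
      moreover have "later A B \<subseteq> later C D" using newu by (auto simp: later_def u_def)
      moreover have "finite (later C D)" using finZ by (rule rev_finite_subset) (auto simp: later_def)
      ultimately have "card (later A B) < card (later C D)" by (metis psubset_card_mono psubsetI)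
      then obtain N l where "\<And>z. (F ^^ N) (mob A' B' A B z, Fin y') = (shift l z, Fin (Y + of_int l))"
        "\<bar>X + of_int l\<bar> \<le> 1" "\<bar>X - Y\<bar> / 2 \<le> \<bar>Y + of_int l\<bar>"
        using less.hyps[OF _ det' False x' y' str'] newv newu u by (force simp: L_def u_def)
      moreover from this have "(F ^^ (N + (n + 1))) (mob A B C D z, Fin y) = (shift l z, Fin (Y + of_int l))" for z
        unfolding funpow_add[of N] comp_apply iter by simp
      ultimately show ?thesis by blast
    qed
  qed
qed

text \<open>The same statement for an arbitrary point of $\Theta_{a,b}$: translations into the strip leave $(C, D)$ unchanged.\<close>

lemma descent:
  fixes X Y :: real
  assumes X: "X \<notin> \<rat>" and Y: "gen Y" and big: "4 * ratio_const < \<bar>X - Y\<bar>"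
    and det: "A * D - B * C = 1" and "C \<noteq> 0"
    and x: "x = (of_int A * X + of_int B) / (of_int C * X + of_int D)"
    and y: "y = (of_int A * Y + of_int B) / (of_int C * Y + of_int D)"
    and Th: "in_Theta a b x y"
    and v: "\<bar>X - Y\<bar> / 2 \<le> \<bar>of_int C * Y + of_int D\<bar>"
  obtains N k where "\<And>z. (F ^^ N) (mob A B C D z, Fin y) = (shift k z, Fin (Y + of_int k))"
      "\<bar>X + of_int k\<bar> \<le> 1" "\<bar>X - Y\<bar> / 2 \<le> \<bar>Y + of_int k\<bar>"
proof -
  have nz: "of_int C * X + of_int D \<noteq> 0" "of_int C * Y + of_int D \<noteq> 0"
    using det_forms_nonzero[OF X det] det_forms_nonzero[OF generic_irrational[OF Y] det] by auto
  have "gen y" unfolding y by (rule generic_mob[OF Y det])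
  then obtain n k where k: "a < y + of_int k" "y + of_int k < b"
      "in_Theta a b (x + of_int k) (y + of_int k)"
      "\<And>z. (F ^^ n) (z, Fin y) = (shift k z, Fin (y + of_int k))"
    using reach_strip Th by blast
  define A' B' where "A' = A + k * C" and "B' = B + k * D"
  have det': "A' * D - B' * C = 1" using det by (simp add: A'_def B'_def algebra_simps)
  have "x + of_int k = (of_int A' * X + of_int B') / (of_int C * X + of_int D)"
       "y + of_int k = (of_int A' * Y + of_int B') / (of_int C * Y + of_int D)"
    using nz by (auto simp: x y A'_def B'_def field_simps)
  from descent_strip[OF X Y big _ det' \<open>C \<noteq> 0\<close> this k(3,1,2) v order_refl] nz
  obtain N l where Nl: "\<And>z. (F ^^ N) (mob A' B' C D z, Fin (y + of_int k)) = (shift l z, Fin (Y + of_int l))"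
      "\<bar>X + of_int l\<bar> \<le> 1" "\<bar>X - Y\<bar> / 2 \<le> \<bar>Y + of_int l\<bar>"
    by auto
  have "(F ^^ (N + n)) (mob A B C D z, Fin y) = (shift l z, Fin (Y + of_int l))" for z
    unfolding funpow_add comp_apply k(4) using Nl(1) by (simp add: shift_mob A'_def B'_def)
  with Nl show ?thesis using that by blast
qed

section \<open>Backward orbits and the attractor\<close>

text \<open>Positions on the backward geodesic of $(X, Y)$. For $s = 1$ the image $\gamma X$ lies in $(1, \infty)$ and the image
$\gamma Y$ in $(-1, 0)$; for $s = -1$ the signs are reversed. One of the two regions is contained in
$\Theta_{a,b}$. The range of $\gamma\infty = A / C$ makes a backward step contract it along with
$\gamma Y$, and the last condition says that it is close to $\gamma Y$, as \<open>descent\<close> requires.\<close>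

definition back_state :: "real \<Rightarrow> real \<Rightarrow> int \<Rightarrow> int \<Rightarrow> int \<Rightarrow> int \<Rightarrow> int \<Rightarrow> bool" where
  "back_state X Y s A B C D \<longleftrightarrow> A * D - B * C = 1 \<and> C \<noteq> 0 \<and>
     1 < of_int s * ((of_int A * X + of_int B) / (of_int C * X + of_int D)) \<and>
     of_int s * ((of_int A * Y + of_int B) / (of_int C * Y + of_int D)) \<in> {-1<..<0} \<and>
     of_int s * (of_int A / of_int C :: real) \<in> {-1..0} \<and>
     \<bar>X - Y\<bar> / 2 \<le> \<bar>of_int C * Y + of_int D\<bar>"

definition pole_dist :: "real \<Rightarrow> int \<Rightarrow> int \<Rightarrow> int \<Rightarrow> int \<Rightarrow> real" where
  "pole_dist Y A B C D = \<bar>(of_int A * Y + of_int B) / (of_int C * Y + of_int D) - of_int A / of_int C\<bar>"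

text \<open>One step of the continued fraction expansion of $\gamma X$: removing the integer part and inverting expands the first
coordinate and contracts the second one together with the cusp. The strictly decreasing distance
between the latter two shows that no position is ever repeated.\<close>

lemma back_step:
  fixes X Y :: real
  assumes X: "X \<notin> \<rat>" and Y: "Y \<notin> \<rat>" and s: "s = 1 \<or> s = - 1" and st: "back_state X Y s A B C D"
  shows "\<exists>A' B' C' D'. back_state X Y (- s) A' B' C' D' \<and> pole_dist Y A' B' C' D' < pole_dist Y A B C D"
proof -
  have det: "A * D - B * C = 1" using st by (simp add: back_state_def)
  define x y c where "x = (of_int A * X + of_int B) / (of_int C * X + of_int D)"
    and "y = (of_int A * Y + of_int B) / (of_int C * Y + of_int D)"
    and "c = (of_int A / of_int C :: real)"
  have R: "C \<noteq> 0" "1 < of_int s * x" "- 1 < of_int s * y" "of_int s * y < 0"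
    "- 1 \<le> of_int s * c" "of_int s * c \<le> 0" "\<bar>X - Y\<bar> / 2 \<le> \<bar>of_int C * Y + of_int D\<bar>"
    using st by (auto simp: back_state_def x_def y_def c_def)
  have nz: "of_int C * X + of_int D \<noteq> 0" "of_int C * Y + of_int D \<noteq> 0"
    using det_forms_nonzero[OF X det] det_forms_nonzero[OF Y det] by auto
  have x: "x \<notin> \<rat>" unfolding x_def by (rule mob_irrational[OF X det])
  define k where "k = \<lfloor>of_int s * x\<rfloor>"
  have k1: "1 \<le> k" using R by (simp add: k_def le_floor_iff)
  have kx: "of_int k < of_int s * x" "of_int s * x < of_int k + 1"
  proof -
    have "of_int k \<noteq> of_int s * x"
    proof
      assume "of_int k = of_int s * x"
      then have "x = of_int (s * k)" using s by auto
      then show False using x by (metis Rats_of_int)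
    qed
    then show "of_int k < of_int s * x" "of_int s * x < of_int k + 1"
      unfolding k_def by linarith+
  qed
  define t where "t = s * k"
  define C' D' where "C' = A - t * C" and "D' = B - t * D"
  have det': "(- C) * D' - (- D) * C' = 1" using det by (simp add: C'_def D'_def algebra_simps)
  have C'X: "of_int C' * X + of_int D' = (x - of_int t) * (of_int C * X + of_int D)"
    and C'Y: "of_int C' * Y + of_int D' = (y - of_int t) * (of_int C * Y + of_int D)"
    and C'c: "of_int C' = (c - of_int t) * of_int C"
    using nz R(1) by (simp_all add: C'_def D'_def x_def y_def c_def field_simps)
  have st_: "of_int s * (z - of_int t) = of_int s * z - of_int k" for z :: real
    using s by (auto simp: t_def algebra_simps)
  have sinv: "of_int s * (- 1 / w) = - 1 / (of_int s * w)" for w :: real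
    using s by auto
  have x': "(of_int (- C) * X + of_int (- D)) / (of_int C' * X + of_int D') = - 1 / (x - of_int t)"
    and y': "(of_int (- C) * Y + of_int (- D)) / (of_int C' * Y + of_int D') = - 1 / (y - of_int t)"
    and c': "of_int (- C) / of_int C' = - 1 / (c - of_int t)"
  proof -
    have neg: "of_int (- C) * w + of_int (- D) = - (of_int C * w + of_int D)" for w :: real by simp
    have cancel: "- w / (r * w) = - 1 / r" if "w \<noteq> 0" for r w :: real using that by simp
    show "(of_int (- C) * X + of_int (- D)) / (of_int C' * X + of_int D') = - 1 / (x - of_int t)"
      "(of_int (- C) * Y + of_int (- D)) / (of_int C' * Y + of_int D') = - 1 / (y - of_int t)"
      unfolding neg C'X C'Y by (rule cancel[OF nz(1)], rule cancel[OF nz(2)])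
    show "of_int (- C) / of_int C' = - 1 / (c - of_int t)"
      unfolding C'c using R(1) by simp
  qed
  have k1': "1 \<le> real_of_int k" using k1 by simp
  have ya: "1 < \<bar>y - of_int t\<bar>" and ca: "1 \<le> \<bar>c - of_int t\<bar>"
    using R k1' st_[of y] st_[of c] s by auto
  have "back_state X Y (- s) (- C) (- D) C' D'"
    unfolding back_state_def x' y' c'
  proof (intro conjI det')
    show "C' \<noteq> 0" using C'c ca R(1) by auto
    show "1 < of_int (- s) * (- 1 / (x - of_int t))"
      using kx st_[of x] sinv[of "x - of_int t"] by (simp add: field_simps)
    show "of_int (- s) * (- 1 / (y - of_int t)) \<in> {- 1<..<0}"
      using R k1' st_[of y] sinv[of "y - of_int t"] by (simp add: field_simps)
    show "of_int (- s) * (- 1 / (c - of_int t)) \<in> {- 1..0}"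
      using R k1' st_[of c] sinv[of "c - of_int t"] by (simp add: field_simps)
    have "1 * \<bar>of_int C * Y + of_int D\<bar> \<le> \<bar>y - of_int t\<bar> * \<bar>of_int C * Y + of_int D\<bar>"
      using ya by (intro mult_right_mono) auto
    then show "\<bar>X - Y\<bar> / 2 \<le> \<bar>of_int C' * Y + of_int D'\<bar>"
      unfolding C'Y abs_mult mult_1 by (rule order_trans[OF R(7)])
  qed
  moreover have "pole_dist Y (- C) (- D) C' D' < pole_dist Y A B C D"
  proof -
    have pd: "pole_dist Y A B C D = \<bar>y - c\<bar>" by (simp add: pole_dist_def y_def c_def)
    have "y - c \<noteq> 0"
    proof -
      have "y \<notin> \<rat>" unfolding y_def by (rule mob_irrational[OF Y det])
      moreover have "c \<in> \<rat>" by (simp add: c_def)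
      ultimately show ?thesis by auto
    qed
    have "pole_dist Y (- C) (- D) C' D' = \<bar>- 1 / (y - of_int t) - - 1 / (c - of_int t)\<bar>"
      unfolding pole_dist_def y' c' ..
    also have "- 1 / (y - of_int t) - - 1 / (c - of_int t) = (y - c) / ((y - of_int t) * (c - of_int t))"
      using ya ca by (subst diff_frac_eq) auto
    also have "\<bar>\<dots>\<bar> = \<bar>y - c\<bar> / (\<bar>y - of_int t\<bar> * \<bar>c - of_int t\<bar>)" by (simp add: abs_mult)
    also have "\<dots> < \<bar>y - c\<bar>"
    proof -
      have "1 < \<bar>y - of_int t\<bar> * \<bar>c - of_int t\<bar>"
        using ya ca by (metis less_le_trans mult.right_neutral mult_left_mono abs_ge_zero)
      then show ?thesis using \<open>y - c \<noteq> 0\<close> by (simp add: divide_less_eq)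
    qed
    finally show ?thesis unfolding pd .
  qed
  ultimately show ?thesis by blast
qed

lemma back_state_exists:
  fixes X Y :: real
  assumes X: "X \<notin> \<rat>" and XY: "X + 2 \<le> Y"
  shows "\<exists>A B C D. back_state X Y 1 A B C D"
proof -
  define k where "k = - \<lfloor>X\<rfloor> - 1"
  have "of_int \<lfloor>X\<rfloor> \<noteq> X" using X by (metis Rats_of_int)
  then have Xk: "- 1 < X + of_int k" "X + of_int k < 0" unfolding k_def by (simp; linarith)+
  have "\<bar>X - Y\<bar> = Y - X" using XY by simp
  moreover have "Y - X - 1 < Y + of_int k" using Xk by linarith
  then have "1 < Y + of_int k" "(Y - X) / 2 \<le> Y + of_int k"
    using XY by (simp_all add: field_simps)
  ultimately have Yk: "1 < Y + of_int k" "\<bar>X - Y\<bar> / 2 \<le> Y + of_int k" by simp_all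
  have "back_state X Y 1 0 (- 1) 1 k"
    unfolding back_state_def using Xk Yk by (auto simp: field_simps)
  then show ?thesis by blast
qed

text \<open>The backward positions are start points in $\Theta_{a,b}$ whose orbits all end in $(X, Y)$. They are told
apart by the pairs $(\gamma\infty, \gamma Y)$, which $F_{a,b}$ carries to $(\infty, Y)$ along the same words. If all these
orbits were shorter than $n$, infinitely many pairs would lie in a finite union of finite preimages.\<close>

lemma far_left_in_attractor:
  fixes X Y :: real
  assumes X: "X \<notin> \<rat>" and Y: "gen Y" and "X \<le> - 4 * ratio_const - 3" and Yb: "b - 1 \<le> Y"
  shows "(Fin X, Fin Y) \<in> attractor a b"
proof -
  have big: "4 * ratio_const < \<bar>X - Y\<bar>" and XY: "X + 2 \<le> Y" and X1: "X < - 1"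
    using assms(3) Yb b_pos ratio_const_ge_1 by linarith+
  have Yirr: "Y \<notin> \<rat>" using Y generic_irrational by blast
  \<comment> \<open>The sign whose region of start points lies in $\Theta_{a,b}$: the lower part
    for $b \ge 1$, where $a > -1$, and the upper part otherwise.\<close>
  define s :: int where "s = (if 1 \<le> b then 1 else - 1)"
  define \<Delta> where "\<Delta> = {\<delta>. \<exists>A B C D. back_state X Y s A B C D \<and> \<delta> = pole_dist Y A B C D}"
  have "\<Delta> \<noteq> {}"
  proof -
    obtain A B C D where 1: "back_state X Y 1 A B C D" using back_state_exists[OF X XY] by blast
    then obtain A' B' C' D' where "back_state X Y (- 1) A' B' C' D'"
      using back_step[OF X Yirr, of 1] by blast
    with 1 show ?thesis unfolding \<Delta>_def s_def by (cases "1 \<le> b") auto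
  qed
  moreover have "\<exists>\<delta>'\<in>\<Delta>. \<delta>' < \<delta>" if \<delta>: "\<delta> \<in> \<Delta>" for \<delta>
  proof -
    have s: "s = 1 \<or> s = - 1" "- s = 1 \<or> - s = - 1" by (auto simp: s_def)
    obtain A B C D where 1: "back_state X Y s A B C D" "\<delta> = pole_dist Y A B C D"
      using \<delta> unfolding \<Delta>_def by blast
    obtain A' B' C' D' where 2: "back_state X Y (- s) A' B' C' D'" "pole_dist Y A' B' C' D' < \<delta>"
      using back_step[OF X Yirr s(1) 1(1)] 1(2) by auto
    show ?thesis using back_step[OF X Yirr s(2) 2(1)] 2(2) by (force simp: \<Delta>_def)
  qed
  ultimately have inf: "infinite \<Delta>" by (metis Min_in Min_le not_le)
  show ?thesis
  proof (rule attractorI)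
    fix n
    define P where "P = (\<Union>N<n. {w. (F ^^ N) w = (Infty, Fin Y)})"
    define dst where "dst w = (case w of (Fin c, Fin y) \<Rightarrow> \<bar>y - c\<bar> | _ \<Rightarrow> 0)" for w
    have "finite (dst ` P)" unfolding P_def by (intro finite_imageI) (simp add: finite_funpow_F_preimage)
    then obtain \<delta> where "\<delta> \<in> \<Delta>" "\<delta> \<notin> dst ` P" using inf by (meson finite_subset subsetI)
    then obtain A B C D where st: "back_state X Y s A B C D" and \<delta>: "\<delta> = pole_dist Y A B C D"
      by (auto simp: \<Delta>_def)
    define x y where "x = (of_int A * X + of_int B) / (of_int C * X + of_int D)"
      and "y = (of_int A * Y + of_int B) / (of_int C * Y + of_int D)"
    have det: "A * D - B * C = 1" and "C \<noteq> 0" and v: "\<bar>X - Y\<bar> / 2 \<le> \<bar>of_int C * Y + of_int D\<bar>"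
      and R: "1 < of_int s * x" "- 1 < of_int s * y" "of_int s * y < 0"
      using st by (auto simp: back_state_def x_def y_def)
    have Th: "in_Theta a b x y"
    proof (cases "1 \<le> b")
      case True
      then have "1 < x" "y < 0" "- 1 < a" using R b_less_1_or by (auto simp: s_def)
      then show ?thesis by (auto simp: in_Theta_def Theta_up_def)
    next
      case False
      then have "x < - 1" "0 < y" using R by (auto simp: s_def)
      then show ?thesis using False by (auto simp: in_Theta_def Theta_up_def)
    qed
    obtain N k where Nk: "\<And>z. (F ^^ N) (mob A B C D z, Fin y) = (shift k z, Fin (Y + of_int k))"
      and Xk: "\<bar>X + of_int k\<bar> \<le> 1"
      using descent[OF X Y big det \<open>C \<noteq> 0\<close> x_def y_def Th v] by blast
    have "0 \<le> k" using Xk X1 by linarith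
    then have kn: "int (nat k) = k" "real (nat k) = of_int k" by auto
    have iter: "(F ^^ (nat k + N)) (mob A B C D z, Fin y) = (z, Fin Y)" for z
      unfolding funpow_add comp_apply Nk using funpow_shift_down[OF Yb, of "nat k" z] kn by simp
    have "n \<le> nat k + N"
    proof (rule ccontr)
      assume "\<not> n \<le> nat k + N"
      then have "(mob A B C D Infty, Fin y) \<in> P" using iter[of Infty] by (auto simp: P_def)
      moreover have "dst (mob A B C D Infty, Fin y) = \<delta>"
        using \<open>C \<noteq> 0\<close> by (simp add: dst_def \<delta> pole_dist_def y_def)
      ultimately show False using \<open>\<delta> \<notin> dst ` P\<close> by blast
    qed
    moreover have "(Fin x, Fin y) \<in> gen_Theta"
    proof -
      have "x \<noteq> y" using R by (auto simp: s_def split: if_splits)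
      then show ?thesis unfolding gen_Theta_def
        using Th mob_irrational[OF X det] generic_mob[OF Y det] by (auto simp: x_def y_def)
    qed
    moreover have "(F ^^ (nat k + N)) (Fin x, Fin y) = (Fin X, Fin Y)"
      using iter[of "Fin X"] det_forms_nonzero[OF X det] by (simp add: x_def)
    ultimately show "\<exists>q\<in>gen_Theta. \<exists>N\<ge>n. (F ^^ N) q = (Fin X, Fin Y)" by blast
  qed
qed

section \<open>Forward orbits reach the attractor\<close>

text \<open>For $a + 1 < y < b - 1$ no point $(w, y)$ belongs to $\Theta_{a,b}$, which is why such $y$ are excluded
here; the map $S$ moves them out of this interval.\<close>

lemma reach_attractor:
  fixes x y :: real
  assumes x: "x \<notin> \<rat>" and y: "gen y" and "x \<noteq> y"
    and W: "well_approx_above y"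
    and no_gap: "y \<le> a + 1 \<or> b - 1 \<le> y"
  shows "\<exists>N>0. (F ^^ N) (Fin x, Fin y) \<in> attractor a b"
proof -
  have yirr: "y \<notin> \<rat>" using y generic_irrational by blast
  obtain m :: nat where m: "\<bar>y\<bar> + 1 \<le> real m" using real_arch_simple by blast
  \<comment> \<open>The auxiliary first coordinate: an integer translate of $y$, hence irrational, in the unbounded rectangle over $y$.\<close>
  define w where "w = (if b - 1 \<le> y then y - real m else y + real m)"
  have wy: "\<bar>w - y\<bar> = real m" "1 \<le> real m" using m by (auto simp: w_def)
  have w: "w \<notin> \<rat>" using irrational_shift[OF yirr, of "int m"] irrational_shift[OF yirr, of "- int m"]
    by (auto simp: w_def)
  have Th: "in_Theta a b w y"
  proof (cases "b - 1 \<le> y")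
    case True
    then have "w \<le> - 1" using m unfolding w_def by simp
    then show ?thesis using True unfolding in_Theta_def Theta_up_def by blast
  next
    case False
    then have "- w \<le> - 1" "- a - 1 \<le> - y" using m no_gap unfolding w_def by simp_all
    then show ?thesis unfolding in_Theta_def Theta_up_def by blast
  qed
  \<comment> \<open>After the excursion, $J$ steps $T^{-1}$ bring a first coordinate that is at most $2$ to the far left region.
    An excursion of size $\Lambda$ leaves enough height above $b$ for all of them. The
    parameter $\epsilon$ makes the excursion that deep and places $p/q$ closer to $y$ than to $x$ and $w$; the lower bound
    $q_0$ for the denominator makes the images of $x$ and $w$ lie within distance $1$.\<close>
  define J where "J = nat \<lceil>4 * ratio_const\<rceil> + 5"
  have J: "4 * ratio_const + 5 \<le> real J" by (simp add: J_def) linarith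
  define \<Lambda> where "\<Lambda> = 4 * ratio_const + 2 * (real J + b) + 2"
  have \<Lambda>: "0 < \<Lambda>" using ratio_const_ge_1 b_pos by (simp add: \<Lambda>_def)
  define \<epsilon> where "\<epsilon> = Min {1 / 2, \<bar>x - y\<bar> / 2, 1 / (2 * \<Lambda>)}"
  have \<epsilon>: "0 < \<epsilon>" "\<epsilon> \<le> 1 / 2" "\<epsilon> \<le> \<bar>x - y\<bar> / 2" "\<epsilon> \<le> 1 / (2 * \<Lambda>)"
  proof -
    show "0 < \<epsilon>" using \<open>x \<noteq> y\<close> \<Lambda> by (simp add: \<epsilon>_def)
    show "\<epsilon> \<le> 1 / 2" "\<epsilon> \<le> \<bar>x - y\<bar> / 2" "\<epsilon> \<le> 1 / (2 * \<Lambda>)"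
      unfolding \<epsilon>_def by (rule Min_le; simp)+
  qed
  define q0 where "q0 = \<lceil>4 * \<bar>x - w\<bar> / \<bar>x - y\<bar>\<rceil> + 1"
  obtain A C where AC: "coprime A C" "q0 \<le> C" "0 < C" "y < of_int A / of_int C"
      "of_int A / of_int C < y + \<epsilon> / (of_int C)\<^sup>2"
    using W \<epsilon>(1) unfolding well_approx_above_def approx_above_def by blast
  obtain D B where det: "A * D - B * C = 1"
  proof -
    obtain u v where "u * A + v * C = 1" using bezout_int[of A C] AC(1) by auto
    then show ?thesis using that[of u "- v"] by (simp add: algebra_simps)
  qed
  define c where "c = (of_int A / of_int C :: real)"
  define q where "q = real_of_int C"
  have q: "1 \<le> q" "4 * \<bar>x - w\<bar> / \<bar>x - y\<bar> \<le> q"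
    using AC(2,3) unfolding q_def q0_def by linarith+
  have c: "y < c" "c < y + \<epsilon> / q\<^sup>2" using AC by (simp_all add: c_def q_def)
  have qq: "q \<le> q\<^sup>2" using q by (simp add: power2_eq_square)
  have "\<epsilon> / q\<^sup>2 \<le> \<epsilon> / 1" using q qq \<epsilon> by (intro divide_left_mono) auto
  then have ce: "c < y + \<epsilon>" using c by simp
  have form: "of_int A - of_int C * z = q * (c - z)" for z
    using AC(3) by (simp add: q_def c_def algebra_simps)
  define X Y X' where "X = (of_int D * w - of_int B) / (of_int A - of_int C * w)"
    and "Y = (of_int D * y - of_int B) / (of_int A - of_int C * y)"
    and "X' = (of_int D * x - of_int B) / (of_int A - of_int C * x)"
  note iX = mob_inverse[OF w det, folded X_def]
    and iY = mob_inverse[OF yirr det, folded Y_def]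
    and iX' = mob_inverse[OF x det, folded X'_def]
  have det': "D * A - (- B) * (- C) = 1" using det by (simp add: algebra_simps)
  have genY: "gen Y" using generic_mob[OF y det'] by (simp add: Y_def)
  have diff: "(of_int D * s - of_int B) / (of_int A - of_int C * s)
      - (of_int D * t - of_int B) / (of_int A - of_int C * t)
      = (s - t) / ((q * (c - s)) * (q * (c - t)))"
    if "of_int A - of_int C * s \<noteq> 0" "of_int A - of_int C * t \<noteq> 0" for s t :: real
    using mob_diff[OF det', of s t] that by (simp add: form[symmetric])
  have XY: "Y - X = (y - w) / ((q * (c - y)) * (q * (c - w)))"
    unfolding X_def Y_def by (rule diff[OF iY(1) iX(1)])
  have X'X: "X' - X = (x - w) / ((q * (c - x)) * (q * (c - w)))"
    unfolding X_def X'_def by (rule diff[OF iX'(1) iX(1)])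
  have "1 \<le> \<bar>w - y\<bar>" using wy by simp
  then have cw: "\<bar>w - y\<bar> \<le> 2 * \<bar>c - w\<bar>" "\<bar>c - w\<bar> \<le> 2 * \<bar>w - y\<bar>"
    using c(1) ce \<epsilon>(2) by (smt (verit, best) field_sum_of_halves)+
  have "2 * \<epsilon> \<le> \<bar>x - y\<bar>" using \<epsilon>(3) by simp
  then have cx: "\<bar>x - y\<bar> \<le> 2 * \<bar>c - x\<bar>" using c(1) ce by (smt (verit))
  have cwpos: "0 < \<bar>c - w\<bar>" using cw(1) \<open>1 \<le> \<bar>w - y\<bar>\<close> by (smt (verit))
  have cy: "0 < c - y" "q * (q * (c - y)) \<le> \<epsilon>"
  proof -
    show "0 < c - y" using c by simp
    have "q\<^sup>2 * (c - y) \<le> q\<^sup>2 * (\<epsilon> / q\<^sup>2)" using c q by (intro mult_left_mono) auto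
    then show "q * (q * (c - y)) \<le> \<epsilon>" using q by (simp add: power2_eq_square mult.assoc)
  qed
  \<comment> \<open>This uses $c > y$: the image of $y$ has to be a large positive number, not a large negative one.\<close>
  have "X < Y"
  proof -
    have "0 < (y - w) * (c - w)"
    proof (cases "w < y")
      case True then show ?thesis using c by (intro mult_pos_pos) auto
    next
      case False
      then have "c < w" using ce \<epsilon>(2) \<open>1 \<le> \<bar>w - y\<bar>\<close> by (smt (verit) field_sum_of_halves)
      then show ?thesis using c by (intro mult_neg_neg) auto
    qed
    then have "0 < (y - w) / (c - w)" by (simp add: zero_less_divide_iff zero_less_mult_iff)
    then have "0 < (y - w) / (c - w) / (q * q * (c - y))"
      by (rule divide_pos_pos) (use q cy(1) in \<open>auto intro!: mult_pos_pos\<close>)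
    also have "\<dots> = Y - X" unfolding XY by (simp add: field_simps)
    finally show ?thesis by simp
  qed
  have Lbig: "\<Lambda> \<le> \<bar>X - Y\<bar>"
  proof -
    have "\<bar>X - Y\<bar> = \<bar>w - y\<bar> / (q * (q * (c - y)) * \<bar>c - w\<bar>)"
      using q cy unfolding abs_minus_commute[of X] XY by (simp add: abs_mult abs_minus_commute mult.assoc mult.left_commute)
    moreover have "q * (q * (c - y)) * \<bar>c - w\<bar> \<le> 1 / (2 * \<Lambda>) * (2 * \<bar>w - y\<bar>)"
      using cy \<epsilon> cw q \<Lambda> by (intro mult_mono) auto
    moreover have "0 < q * (q * (c - y)) * \<bar>c - w\<bar>"
      using q cy(1) cwpos by (intro mult_pos_pos) auto
    moreover have "0 < \<bar>w - y\<bar>" using wy by linarith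
    ultimately show ?thesis using \<Lambda> by (simp add: pos_le_divide_eq pos_divide_le_eq mult.commute)
  qed
  have X'X1: "\<bar>X' - X\<bar> \<le> 1"
  proof -
    have "\<bar>x - w\<bar> \<le> q * \<bar>x - y\<bar> / 4" using q(2) \<open>x \<noteq> y\<close> by (simp add: field_simps)
    also have "\<dots> = q * (\<bar>x - y\<bar> / 2) * (1 * (1 / 2))" by simp
    also have "\<dots> \<le> q * \<bar>c - x\<bar> * (q * \<bar>c - w\<bar>)"
      using q cx cw \<open>1 \<le> \<bar>w - y\<bar>\<close> by (intro mult_mono) auto
    finally have "\<bar>x - w\<bar> \<le> q * \<bar>c - x\<bar> * (q * \<bar>c - w\<bar>)" .
    moreover have "0 < \<bar>c - x\<bar>" using cx \<open>x \<noteq> y\<close> by (smt (verit))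
    ultimately show ?thesis unfolding X'X using q cwpos by (simp add: abs_mult)
  qed
  have v: "\<bar>X - Y\<bar> / 2 \<le> \<bar>of_int C * Y + of_int D\<bar>"
  proof -
    have "\<bar>X - Y\<bar> = \<bar>w - y\<bar> / (q * \<bar>c - w\<bar>) / (q * (c - y))"
      using q cy unfolding abs_minus_commute[of X] XY by (simp add: abs_mult abs_minus_commute mult.commute)
    also have "\<dots> \<le> 2 / (q * (c - y))"
    proof (rule divide_right_mono)
      have "\<bar>w - y\<bar> \<le> 2 * (1 * \<bar>c - w\<bar>)" using cw by simp
      also have "\<dots> \<le> 2 * (q * \<bar>c - w\<bar>)" using q by (intro mult_left_mono mult_right_mono) auto
      finally show "\<bar>w - y\<bar> / (q * \<bar>c - w\<bar>) \<le> 2" using q cwpos by (simp add: pos_divide_le_eq)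
    qed (use q cy in auto)
    finally show ?thesis unfolding iY(2) form using q cy by simp
  qed
  have big: "4 * ratio_const < \<bar>X - Y\<bar>"
    using Lbig b_pos of_nat_0_le_iff[of J, where ?'a = real] unfolding \<Lambda>_def by (smt (verit))
  have "C \<noteq> 0" using AC(3) by simp
  obtain N k where Nk: "\<And>z. (F ^^ N) (mob A B C D z, Fin y) = (shift k z, Fin (Y + of_int k))"
      "\<bar>X + of_int k\<bar> \<le> 1" "\<bar>X - Y\<bar> / 2 \<le> \<bar>Y + of_int k\<bar>"
    using descent[OF iX(4) genY big det \<open>C \<noteq> 0\<close> iX(3)[symmetric] iY(3)[symmetric] Th v] by blast
  have "mob A B C D (Fin X') = Fin x"
    using iX' by simp
  then have FN: "(F ^^ N) (Fin x, Fin y) = (Fin (X' + of_int k), Fin (Y + of_int k))"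
    using Nk(1)[of "Fin X'"] by simp
  have "\<bar>X - Y\<bar> \<le> 2 * \<bar>Y + of_int k\<bar>" using Nk(3) by simp
  then have Yk: "real J + b \<le> Y + of_int k"
    using Nk(2) Lbig \<open>X < Y\<close> b_pos of_nat_0_le_iff[of J, where ?'a = real] ratio_const_ge_1 unfolding \<Lambda>_def by (smt (verit))
  define X2 Y2 where "X2 = X' + of_int (k - int J)" and "Y2 = Y + of_int (k - int J)"
  have "X2 \<le> - 4 * ratio_const - 3" "b - 1 \<le> Y2"
    using Yk J Nk(2) X'X1 by (auto simp: X2_def Y2_def)
  moreover have "X2 \<notin> \<rat>" "gen Y2"
    unfolding X2_def Y2_def using irrational_shift[OF iX'(4)] generic_shift[OF genY] by blast+
  ultimately have att: "(Fin X2, Fin Y2) \<in> attractor a b" using far_left_in_attractor by blast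
  have "(F ^^ (J + N)) (Fin x, Fin y) = (F ^^ J) (shift (int J) (Fin X2), Fin (Y2 + real J))"
    unfolding funpow_add comp_apply FN by (simp add: X2_def Y2_def)
  also have "\<dots> = (Fin X2, Fin Y2)" by (rule funpow_shift_down) fact
  finally have "(F ^^ (J + N)) (Fin x, Fin y) \<in> attractor a b" using att by simp
  moreover have "0 < J + N" by (simp add: J_def)
  ultimately show ?thesis by blast
qed

end

lemma countable_not_generic: "countable {y. y \<notin> \<rat> \<and> \<not> generic a b y}"
proof -
  define g where "g = (\<lambda>((A, B), (C, D), t). (of_int D * t - of_int B) / (of_int A - of_int C * t) :: real)"
  have "{y. y \<notin> \<rat> \<and> \<not> generic a b y} \<subseteq> g ` (UNIV \<times> UNIV \<times> {a, b})"
  proof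
    fix y assume "y \<in> {y. y \<notin> \<rat> \<and> \<not> generic a b y}"
    then obtain A B C D where y: "y \<notin> \<rat>" and det: "A * D - B * C = 1"
      and t: "(of_int A * y + of_int B) / (of_int C * y + of_int D) \<in> {a, b}"
      unfolding generic_def by blast
    define t where "t = (of_int A * y + of_int B) / (of_int C * y + of_int D)"
    have det': "D * A - (- B) * (- C) = 1" using det by (simp add: algebra_simps)
    have "y = (of_int D * t - of_int B) / (of_int A - of_int C * t)"
      using mob_inverse(3)[OF y det'] by (simp add: t_def add.commute)
    then have "y = g ((A, B), (C, D), t)" by (simp add: g_def)
    then show "y \<in> g ` (UNIV \<times> UNIV \<times> {a, b})" using t unfolding t_def[symmetric] by blast
  qed
  then show ?thesis by (rule countable_subset) (auto intro!: countable_image countable_SIGMA)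
qed

text \<open>Good approximability is needed for $y$ and for $-1/y$, because the main argument may start only after one step $S$.\<close>

lemma negligible_bad: "negligible {y. \<not> (generic a b y \<and> well_approx_above y \<and> well_approx_above (- 1 / y))}"
proof -
  define N where "N = {y. y \<notin> \<rat> \<and> \<not> well_approx_above y}"
  have N: "negligible N"
    using negligible_not_well_approx_above by (simp add: N_def)
  have SN: "negligible ((\<lambda>y. - 1 / y) ` (N - {0}))"
  proof (rule negligible_differentiable_image_negligible)
    show "(\<lambda>y::real. - 1 / y) differentiable_on N - {0}"
      by (auto simp: differentiable_on_def intro!: derivative_intros)
  qed (use N negligible_diff in auto)
  have cn: "negligible S" if "countable S" for S :: "real set"
    unfolding negligible_iff_null_sets
    by (rule null_sets_completionI[OF countable_imp_null_set_lborel[OF that]])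
  have "negligible (\<rat> :: real set)" "negligible {y. y \<notin> \<rat> \<and> \<not> generic a b y}"
    by (rule cn[OF countable_rat], rule cn[OF countable_not_generic])
  then have "negligible (\<rat> \<union> {y. y \<notin> \<rat> \<and> \<not> generic a b y} \<union> N \<union> (\<lambda>y. - 1 / y) ` (N - {0}))"
    using N SN by (intro negligible_Un)
  then show ?thesis
  proof (rule negligible_subset, intro subsetI)
    fix y assume y: "y \<in> {y. \<not> (generic a b y \<and> well_approx_above y \<and> well_approx_above (- 1 / y))}"
    show "y \<in> \<rat> \<union> {y. y \<notin> \<rat> \<and> \<not> generic a b y} \<union> N \<union> (\<lambda>y. - 1 / y) ` (N - {0})"
    proof (cases "y \<notin> \<rat> \<and> generic a b y \<and> y \<notin> N")
      case True
      then have "- 1 / y \<in> N - {0}" using y irrational_S by (auto simp: N_def)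
      moreover have "y = - 1 / (- 1 / y)" by simp
      ultimately show ?thesis by blast
    qed blast
  qed
qed

theorem proposition7p2:
  fixes a b :: real
  assumes "(a, b) \<in> params"
    and "a \<noteq> 0" and "b \<noteq> 0" and "(a, b) \<noteq> (- 1, 1)"
    and "finiteness_condition a b"
  shows "almost_every_off_diagonal (\<lambda>p. \<exists>N>0. (F_map a b ^^ N) p \<in> attractor a b)"
proof -
  interpret admissible a b
    using assms by unfold_locales (auto simp: params_def)
  have good: "\<exists>N>0. (F ^^ N) (Fin x, Fin y) \<in> attractor a b"
    if x: "x \<notin> \<rat>" and "x \<noteq> y"
      and y: "generic a b y" "well_approx_above y" "well_approx_above (- 1 / y)" for x y
  proof (cases "y \<le> a + 1 \<or> b - 1 \<le> y")
    case True
    then show ?thesis using reach_attractor[OF x y(1) \<open>x \<noteq> y\<close> y(2)] by blast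
  next
    case False
    have nz: "x \<noteq> 0" "y \<noteq> 0" using x y(1) irrational_nz generic_irrational by blast+
    have FS: "F (Fin x, Fin y) = (Fin (- 1 / x), Fin (- 1 / y))" using False nz by simp
    have "- 1 / y \<le> a + 1 \<or> b - 1 \<le> - 1 / y"
    proof (cases "0 < y")
      case True
      then have "- 1 / y \<le> - 1 / b" using False b_pos by (simp add: field_simps)
      then show ?thesis using recip_b by linarith
    next
      case neg: False
      then have "- 1 / a \<le> - 1 / y" using False nz a_neg by (simp add: field_simps)
      then show ?thesis using recip_a by linarith
    qed
    moreover have "- 1 / x \<noteq> - 1 / y" using \<open>x \<noteq> y\<close> nz by simp
    ultimately obtain N where "(F ^^ N) (Fin (- 1 / x), Fin (- 1 / y)) \<in> attractor a b"
      using reach_attractor[OF irrational_S[OF x] generic_S[OF y(1)] _ y(3)] by blast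
    then have "(F ^^ Suc N) (Fin x, Fin y) \<in> attractor a b"
      unfolding funpow_Suc_right comp_apply FS .
    then show ?thesis by blast
  qed
  obtain B where B: "B \<in> null_sets lborel"
      "{y. \<not> (generic a b y \<and> well_approx_above y \<and> well_approx_above (- 1 / y))} \<subseteq> B"
    using negligible_bad[of a b] unfolding negligible_iff_null_sets null_sets_completion_iff2 by blast
  have "UNIV \<times> B \<in> null_sets (lborel \<Otimes>\<^sub>M lborel :: (real \<times> real) measure)"
    using B(1) by (intro lborel.times_in_null_sets2) auto
  moreover have "(\<rat> :: real set) \<in> null_sets lborel"
    using countable_rat by (rule countable_imp_null_set_lborel)
  then have "\<rat> \<times> UNIV \<in> null_sets (lborel \<Otimes>\<^sub>M lborel :: (real \<times> real) measure)"
    by (intro lborel.times_in_null_sets1) auto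
  ultimately have "UNIV \<times> B \<union> \<rat> \<times> UNIV \<in> null_sets (lborel :: (real \<times> real) measure)"
    by (simp add: lborel_prod null_sets.Un)
  then have "AE p in (lborel :: (real \<times> real) measure). p \<notin> UNIV \<times> B \<union> \<rat> \<times> UNIV"
    by (rule AE_not_in)
  then show ?thesis
    unfolding almost_every_off_diagonal_def
  proof (rule AE_mp, intro AE_I2 impI)
    fix p :: "real \<times> real"
    assume p: "p \<notin> UNIV \<times> B \<union> \<rat> \<times> UNIV"
    obtain x y where xy: "p = (x, y)" by (cases p)
    have x: "x \<notin> \<rat>" and y: "generic a b y" "well_approx_above y" "well_approx_above (- 1 / y)"
      using p B(2) unfolding xy by auto
    show "case p of (x, y) \<Rightarrow> (Fin x, Fin y) \<notin> diagonal \<longrightarrow>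
        (\<exists>N>0. (F ^^ N) (Fin x, Fin y) \<in> attractor a b)"
      using good[OF x _ y] by (auto simp: xy diagonal_def simp del: F_map.simps)
  qed
qed

end
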